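(* Let $f\in\mathcal{AK}_H$ be sense-preserving and put $b_1=f_{\overline{z}}(0)$. Then for every $z\in\mathbb{D}$ the Jacobian $J_f$ of $f$ satisfies $$(1-|b_1|^2)\frac{(1-|z|)^{\frac{4}{\sqrt{3}}-2}}{(1+|z|)^{\frac{4}{\sqrt{3}}+2}}\le J_f(z)\le(1-|b_1|^2)\frac{(1+|z|)^{\frac{4}{\sqrt{3}}-2}}{(1-|z|)^{\frac{4}{\sqrt{3}}+2}}.$$ Moreover, for $0<r<1$ the area $A(f(\mathbb{D}_r))$ of $f(\mathbb{D}_r)$ satisfies $$\frac{\pi(1-|b_1|^2)}{26}\left\{3-(3r^2+8\sqrt{3}\,r+3)\frac{(1-r)^{\frac{4}{\sqrt{3}}-1}}{(1+r)^{\frac{4}{\sqrt{3}}+1}}\right\}\le A(f(\mathbb{D}_r))$$ and $$A(f(\mathbb{D}_r))\le\frac{\pi(1-|b_1|^2)}{26}\left\{3-(3r^2-8\sqrt{3}\,r+3)\frac{(1+r)^{\frac{4}{\sqrt{3}}-1}}{(1-r)^{\frac{4}{\sqrt{3}}+1}}\right\}.$$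
   Context: $\mathbb{D}=\{z\in\mathbb{C}:|z|<1\}$ and $\mathbb{D}_r=\{z:|z|<r\}$. $\mathcal{H}$ is the class of complex-valued harmonic functions $f=h+\overline{g}$ in $\mathbb{D}$, with $h,g$ analytic in $\mathbb{D}$ and $h(z)=z+\sum_{n\ge2}a_nz^n$, $g(z)=\sum_{n\ge1}b_nz^n$. The Jacobian is $J_f=|f_z|^2-|f_{\overline{z}}|^2=|h'|^2-|g'|^2$, and $f$ is sense-preserving if $J_f>0$ in $\mathbb{D}$. For $a\in\mathbb{D}$, $r>0$, let $\mathbb{D}(a,r)=\{z\in\mathbb{D}:|z-a|<r\}$. $\mathcal{AK}_H$ (absolutely convex harmonic mappings) is the class of locally univalent $f\in\mathcal{H}$ such that $f(\mathbb{D}(a,r))$ is convex for all $a\in\mathbb{D}$ and all $r\in(0,1-|a|)$. *)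

theory Defs
  imports "HOL-Complex_Analysis.Complex_Analysis"
begin

text \<open>
  The Wirtinger derivatives \<open>(f\<^sub>x - \<i> f\<^sub>y) / 2\<close> and \<open>(f\<^sub>x + \<i> f\<^sub>y) / 2\<close>, where \<open>f\<^sub>x\<close> and \<open>f\<^sub>y\<close> are the
  values of the real Frechet derivative in the directions \<open>1\<close> and \<open>\<i>\<close>.
\<close>

definition deriv_z :: "(complex \<Rightarrow> complex) \<Rightarrow> complex \<Rightarrow> complex" where
  "deriv_z f z =
     (frechet_derivative f (at z) 1 - \<i> * frechet_derivative f (at z) \<i>) / 2"

definition deriv_zbar :: "(complex \<Rightarrow> complex) \<Rightarrow> complex \<Rightarrow> complex" where
  "deriv_zbar f z =
     (frechet_derivative f (at z) 1 + \<i> * frechet_derivative f (at z) \<i>) / 2"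

definition wirtinger_jacobian :: "(complex \<Rightarrow> complex) \<Rightarrow> complex \<Rightarrow> real" where
  "wirtinger_jacobian f z = (norm (deriv_z f z))\<^sup>2 - (norm (deriv_zbar f z))\<^sup>2"

definition sense_preserving :: "(complex \<Rightarrow> complex) \<Rightarrow> bool" where
  "sense_preserving f \<longleftrightarrow> (\<forall>z\<in>ball 0 1. wirtinger_jacobian f z > 0)"

definition locally_univalent :: "(complex \<Rightarrow> complex) \<Rightarrow> bool" where
  "locally_univalent f \<longleftrightarrow>
     (\<forall>z\<in>ball 0 1. \<exists>U. open U \<and> z \<in> U \<and> U \<subseteq> ball 0 1 \<and> inj_on f U)"

text \<open>
  The conditions on \<open>h\<close> and \<open>g\<close> at \<open>0\<close> say that their Taylor series have the form
  \<open>z + a\<^sub>2 z\<^sup>2 + \<dots>\<close> and \<open>b\<^sub>1 z + b\<^sub>2 z\<^sup>2 + \<dots>\<close>. The values of \<open>f\<close> outside the unit disc are arbitrary.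
\<close>

definition normalized_harmonic :: "(complex \<Rightarrow> complex) set" where
  "normalized_harmonic =
     {f. \<exists>h g. h holomorphic_on ball 0 1 \<and> g holomorphic_on ball 0 1 \<and>
           h 0 = 0 \<and> deriv h 0 = 1 \<and> g 0 = 0 \<and>
           (\<forall>z\<in>ball 0 1. f z = h z + cnj (g z))}"

definition absolutely_convex_harmonic :: "(complex \<Rightarrow> complex) set" where
  "absolutely_convex_harmonic =
     {f \<in> normalized_harmonic. locally_univalent f \<and>
        (\<forall>a\<in>ball 0 1. \<forall>r. 0 < r \<and> r < 1 - norm a \<longrightarrow> convex (f ` ball a r))}"

end

theory Submission imports Defs begin

text \<open>
  Write \<open>J = \<bar>h'\<bar>\<^sup>2 - \<bar>g'\<bar>\<^sup>2\<close>, \<open>\<partial>J = cnj h' h'' - cnj g' g''\<close> (its \<open>z\<close>-derivative) and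
  \<open>W = g' h'' - h' g''\<close>. The Jacobian bounds are the integrated form of the pointwise inequality
    \<open>\<bar>(1 - \<bar>z\<bar>\<^sup>2) \<partial>J - 2 cnj z J\<bar> \<le> (4 / sqrt 3) J\<close>,
  which comes from the convexity of the images of the discs that have \<open>z\<close> on their boundary.

  Univalence comes first. If \<open>f\<close> is injective on the open disc of radius \<open>r < 1\<close>, it is injective on
  the closed disc: two boundary points with a common value \<open>w\<close> would share a supporting line of the
  convex image at \<open>w\<close>, and near each of them the image fills the same side of that line, so that
  values near \<open>w\<close> would be taken twice. By compactness injectivity then persists on a slightly
  larger disc, so the supremum of the admissible radii is \<open>1\<close> (lemma \<open>univalent\<close>). Now \<open>f z\<close> is a
  boundary point of the convex image of every disc that has \<open>z\<close> on its boundary, there is a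
  supporting line, and the curve obtained from the bounding circle must turn to the left at \<open>f z\<close>.
  Computing \<open>Im (cnj F' F'')\<close> for this curve gives, with \<open>z = a + r e\<close> and \<open>\<bar>e\<bar> = 1\<close>,
    \<open>J + r (Re (\<partial>J e) - Re (W e\<^sup>3)) \<ge> 0\<close>.
  The strongest case is the limit of discs internally tangent to the unit circle, and it reads
    \<open>2 J + Re (B e) \<ge> (1 - \<bar>z\<bar>\<^sup>2) Re (W e\<^sup>3)\<close> with \<open>B = (1 - \<bar>z\<bar>\<^sup>2) \<partial>J - 2 cnj z J\<close>.
  Two unit vectors \<open>e\<close> at angles \<open>\<pm> \<pi>/6\<close> from the direction in which \<open>B e\<close> is negative have
  opposite cubes, so the terms with \<open>W\<close> cancel in the sum, while \<open>Re (B e)\<close> contributes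
  \<open>- (sqrt 3 / 2) \<bar>B\<bar>\<close> twice. This is where \<open>4 / sqrt 3\<close> comes from.

  Along a radius the inequality bounds \<open>d/dt ln J\<close> on both sides, and the extremal solutions are the
  function \<open>weight\<close> at \<open>t\<close> and at \<open>- t\<close>. Finally, since \<open>f\<close> is univalent, the area of the image of
  an annulus lies between the extreme values of \<open>J\<close> there times the area of the annulus, and
  comparing increments over finer and finer annuli bounds the area by \<open>\<integral> 2 \<pi> t J(0) weight(\<plusminus> t) dt\<close>.
  Up to a constant factor, these two integrals are the values of one antiderivative
  \<open>weight_primitive\<close> at \<open>r\<close> and at \<open>- r\<close>.
\<close>

section \<open>Real-linear maps and boundary behaviour on discs\<close>

text \<open>
  Every real-linear map of the plane has this form. The differential of \<open>h + cnj g\<close> is the one with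
  \<open>p = h'\<close> and \<open>q = g'\<close>, and its determinant is \<open>\<bar>p\<bar>\<^sup>2 - \<bar>q\<bar>\<^sup>2\<close>.
\<close>

definition real_linear :: "complex \<Rightarrow> complex \<Rightarrow> complex \<Rightarrow> complex" where
  "real_linear p q v = p * v + cnj (q * v)"

lemma bounded_linear_real_linear: "bounded_linear (real_linear p q)"
  unfolding real_linear_def
  by (rule bounded_linear_add[OF bounded_linear_mult_right
        bounded_linear_compose[OF bounded_linear_cnj bounded_linear_mult_right]])

lemma real_linear_surj:
  assumes "norm q < norm p"
  obtains g where "bounded_linear g" "real_linear p q \<circ> g = id"
proof -
  define J where "J = (cmod p)\<^sup>2 - (cmod q)\<^sup>2"
  have "J \<noteq> 0" using assms unfolding J_def
    using power_strict_mono[of "cmod q" "cmod p" 2] by simp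
  have J: "of_real J = p * cnj p - q * cnj q"
    unfolding J_def complex_norm_square[symmetric] by simp
  \<comment> \<open>Cramer's rule for the equation \<open>p v + cnj (q v) = w\<close> and its conjugate\<close>
  define g where "g w = (cnj p * w - cnj (q * w)) / of_real J" for w
  have "bounded_linear g"
    unfolding g_def
    by (rule bounded_linear_compose[OF bounded_linear_divide
          bounded_linear_sub[OF bounded_linear_mult_right
            bounded_linear_compose[OF bounded_linear_cnj bounded_linear_mult_right]]])
  moreover have "real_linear p q (g w) = w" for w
  proof -
    have "real_linear p q (g w) = (p * (cnj p * w - cnj (q * w)) + cnj (q * (cnj p * w - cnj (q * w)))) / of_real J"
      unfolding real_linear_def g_def by (simp add: add_divide_distrib)
    also have "p * (cnj p * w - cnj (q * w)) + cnj (q * (cnj p * w - cnj (q * w))) = of_real J * w"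
      unfolding J by (simp add: algebra_simps)
    finally show ?thesis using \<open>J \<noteq> 0\<close> by simp
  qed
  ultimately show ?thesis using that[of g] by (auto simp: fun_eq_iff)
qed

lemma harmonic_has_derivative:
  assumes h: "h holomorphic_on ball 0 1" and g: "g holomorphic_on ball 0 1"
    and f: "\<And>z. z \<in> ball 0 1 \<Longrightarrow> f z = h z + cnj (g z)" and z: "z \<in> ball 0 1"
  shows "(f has_derivative real_linear (deriv h z) (deriv g z)) (at z)"
proof -
  have 1: "(h has_derivative (*) (deriv h z)) (at z)"
    using holomorphic_derivI[OF h _ z] has_field_derivative_def by blast
  have 2: "(g has_derivative (*) (deriv g z)) (at z)"
    using holomorphic_derivI[OF g _ z] has_field_derivative_def by blast
  have "((\<lambda>z. h z + cnj (g z)) has_derivative real_linear (deriv h z) (deriv g z)) (at z)"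
    unfolding real_linear_def by (intro has_derivative_add 1 has_derivative_cnj[OF 2])
  then show ?thesis
    by (rule has_derivative_transform_within_open[OF _ open_ball z]) (simp add: f)
qed

lemma wirtinger_harmonic:
  assumes "(f has_derivative real_linear p q) (at z)"
  shows "deriv_zbar f z = cnj q" "wirtinger_jacobian f z = (cmod p)\<^sup>2 - (cmod q)\<^sup>2"
proof -
  have *: "frechet_derivative f (at z) = real_linear p q"
    using frechet_derivative_at[OF assms] by simp
  show 1: "deriv_zbar f z = cnj q"
    unfolding deriv_zbar_def * real_linear_def by (simp add: algebra_simps)
  have "deriv_z f z = p"
    unfolding deriv_z_def * real_linear_def by (simp add: algebra_simps)
  with 1 show "wirtinger_jacobian f z = (cmod p)\<^sup>2 - (cmod q)\<^sup>2"
    unfolding wirtinger_jacobian_def by simp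
qed

text \<open>
  The point may lie on the boundary of the convex set: separation, not strict separation, is needed,
  and then the separating line is a supporting line.
\<close>

lemma separating_point:
  fixes w :: complex
  assumes "convex A" "A \<noteq> {}" "w \<notin> A"
  obtains u where "u \<noteq> 0" "\<And>y. y \<in> A \<Longrightarrow> u \<bullet> y \<le> u \<bullet> w"
proof -
  obtain u b where "u \<noteq> 0" "\<forall>x\<in>A. u \<bullet> x \<le> b" "b \<le> u \<bullet> w"
    using separating_hyperplane_sets[of A "{w}"] assms by auto
  then show ?thesis using that[of u] by (meson order_trans)
qed

lemma directional_deriv:
  fixes f :: "complex \<Rightarrow> complex"
  assumes "(f has_derivative f') (at z)"
  shows "((\<lambda>t. u \<bullet> f (z + t *\<^sub>R v)) has_real_derivative (u \<bullet> f' v)) (at 0)"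
proof -
  have 1: "((\<lambda>t::real. z + t *\<^sub>R v) has_derivative (\<lambda>t. t *\<^sub>R v)) (at 0)"
    by (auto intro!: derivative_eq_intros)
  have "((\<lambda>t. f (z + t *\<^sub>R v)) has_derivative (\<lambda>t. f' (t *\<^sub>R v))) (at 0)"
    using has_derivative_compose[OF 1, of f f'] assms by simp
  from has_derivative_inner_right[OF this, of u]
  have "((\<lambda>t. u \<bullet> f (z + t *\<^sub>R v)) has_derivative (\<lambda>t. u \<bullet> f' (t *\<^sub>R v))) (at 0)" .
  moreover have "f' (t *\<^sub>R v) = t *\<^sub>R f' v" for t
    using has_derivative_bounded_linear[OF assms] by (simp add: bounded_linear.linear linear_scale)
  ultimately show ?thesis
    by (simp add: has_field_derivative_def mult_commute_abs)
qed

text \<open>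
  A vector at a boundary point that makes an obtuse angle with the radius enters the disc, where the
  functional is no larger than at the boundary point.
\<close>

lemma inward_directional_derivative_le_0:
  fixes f :: "complex \<Rightarrow> complex"
  assumes der: "(f has_derivative f') (at z)" and z: "norm (z - a) = r"
    and sup: "\<And>x. x \<in> ball a r \<Longrightarrow> u \<bullet> f x \<le> u \<bullet> f z"
    and v: "(z - a) \<bullet> v < 0"
  shows "u \<bullet> f' v \<le> 0"
proof (rule ccontr)
  assume "\<not> ?thesis"
  then obtain d where d: "d > 0" "\<And>t. 0 < t \<Longrightarrow> t < d \<Longrightarrow> u \<bullet> f z < u \<bullet> f (z + t *\<^sub>R v)"
    using DERIV_pos_inc_right[OF directional_deriv[OF der, of u v]] by auto
  have "((\<lambda>t. (z - a + t *\<^sub>R v) \<bullet> (z - a + t *\<^sub>R v)) has_real_derivative 2 * ((z - a) \<bullet> v)) (at 0)"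
  proof -
    have "((\<lambda>t. z - a + t *\<^sub>R v) has_derivative (\<lambda>t. t *\<^sub>R v)) (at 0)"
      by (auto intro!: derivative_eq_intros)
    from has_derivative_inner[OF this this] show ?thesis
      unfolding has_field_derivative_def
      by (rule has_derivative_eq_rhs) (simp add: fun_eq_iff inner_commute)
  qed
  from DERIV_neg_dec_right[OF this] v
  obtain e where e: "e > 0" "\<And>t. 0 < t \<Longrightarrow> t < e \<Longrightarrow>
      (z - a + t *\<^sub>R v) \<bullet> (z - a + t *\<^sub>R v) < (z - a) \<bullet> (z - a)"
    by auto
  define t where "t = min d e / 2"
  have t: "0 < t" "t < d" "t < e" using d e unfolding t_def by auto
  have "norm (z - a + t *\<^sub>R v) < norm (z - a)"
    using e(2)[OF t(1,3)] by (simp add: norm_lt)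
  then have "z + t *\<^sub>R v \<in> ball a r"
    using z by (simp add: dist_norm norm_minus_commute algebra_simps)
  with sup d(2)[OF t(1,2)] show False by fastforce
qed

text \<open>
  The form in which "the image of a disc fills one side of its supporting line locally" is used: the
  normal segment starting at the boundary value and pointing away from the line is covered by the
  image of an arbitrarily small neighbourhood of the boundary point. The preimage \<open>v\<close> of the
  outward normal \<open>u\<close> under the differential must point out of the disc, so the local inverse of \<open>f\<close>
  pulls the segment back to a curve that starts in direction \<open>- v\<close> and enters the disc.
\<close>

lemma boundary_image_covers_normal_segment:
  fixes f :: "complex \<Rightarrow> complex"
  assumes U: "open U" "z \<in> U" "inj_on f U" "continuous_on U f"
    and der: "(f has_derivative real_linear p q) (at z)" and pq: "norm q < norm p"
    and z: "norm (z - a) = r"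
    and sup: "\<And>x. x \<in> ball a r \<Longrightarrow> u \<bullet> f x \<le> u \<bullet> f z" and u: "u \<noteq> 0" and r: "r > 0"
  shows "eventually (\<lambda>t. f z - t *\<^sub>R u \<in> f ` (U \<inter> ball a r)) (at_right 0)"
proof -
  obtain g' where g': "bounded_linear g'" "real_linear p q \<circ> g' = id"
    using real_linear_surj[OF pq] by blast
  define v where "v = g' u"
  have v: "real_linear p q v = u"
    using g'(2) unfolding v_def by (metis comp_apply id_apply)
  have lin: "linear (real_linear p q)"
    using bounded_linear_real_linear by (rule bounded_linear.linear)
  have out: "(z - a) \<bullet> v > 0"
  proof (rule ccontr)
    assume *: "\<not> (z - a) \<bullet> v > 0"
    \<comment> \<open>\<open>v\<close> itself might be tangent to the circle; tilting it slightly inwards makes it enter the disc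
        and still increases the functional, against the choice of \<open>u\<close>\<close>
    define k where "k = u \<bullet> real_linear p q (z - a)"
    have ku: "u \<bullet> u > 0" using u by simp
    define d where "d = (u \<bullet> u) / (2 * (\<bar>k\<bar> + 1))"
    have d: "d > 0" using ku unfolding d_def by (simp add: field_simps)
    have "d * k \<le> d * \<bar>k\<bar>" using d by (intro mult_left_mono) auto
    also have "\<dots> < d * (2 * (\<bar>k\<bar> + 1))" using d by (intro mult_strict_left_mono) auto
    also have "\<dots> = u \<bullet> u" unfolding d_def by (simp add: field_simps)
    finally have "d * k < u \<bullet> u" .
    moreover have "u \<bullet> real_linear p q (v - d *\<^sub>R (z - a)) \<le> 0"
    proof (rule inward_directional_derivative_le_0[OF der z sup])
      have "(z - a) \<bullet> (z - a) > 0" using z r by (metis dot_square_norm zero_less_power)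
      then have "d * ((z - a) \<bullet> (z - a)) > 0" using d by simp
      then show "(z - a) \<bullet> (v - d *\<^sub>R (z - a)) < 0"
        using * unfolding inner_diff_right inner_scaleR_right by linarith
    qed
    then have "u \<bullet> u - d * k \<le> 0"
      unfolding k_def linear_diff[OF lin] linear_scale[OF lin] v inner_diff_right[of u u] by simp
    ultimately show False by simp
  qed
  define G where "G = inv_into U f"
  have GF: "\<And>x. x \<in> U \<Longrightarrow> G (f x) = x" unfolding G_def using U(3) by simp
  have derG: "(G has_derivative g') (at (f z))"
    by (rule has_derivative_inverse_strong[OF U(1,2,4) GF der g'(2)])
  have openfU: "open (f ` U)" by (rule invariance_of_domain[OF U(4,1,3)])
  have t: "((\<lambda>t::real. f z - t *\<^sub>R u) \<longlongrightarrow> f z) (at_right 0)"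
    by (auto intro!: tendsto_eq_intros)
  have e1: "eventually (\<lambda>t. f z - t *\<^sub>R u \<in> f ` U) (at_right 0)"
    using topological_tendstoD[OF t openfU] U(2) by auto
  define k where "k t = (G (f z - t *\<^sub>R u) - a) \<bullet> (G (f z - t *\<^sub>R u) - a)" for t
  have "((\<lambda>t::real. f z - t *\<^sub>R u) has_derivative (\<lambda>t. - (t *\<^sub>R u))) (at 0)"
    by (auto intro!: derivative_eq_intros)
  from has_derivative_compose[OF this, of G g'] derG
  have d1: "((\<lambda>t. G (f z - t *\<^sub>R u)) has_derivative (\<lambda>t. g' (- (t *\<^sub>R u)))) (at 0)" by simp
  have "g' (- (t *\<^sub>R u)) = - (t *\<^sub>R v)" for t
    using g'(1) unfolding v_def by (simp add: bounded_linear.linear linear_scale linear_neg)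
  then have d2: "((\<lambda>t. G (f z - t *\<^sub>R u)) has_derivative (\<lambda>t. - (t *\<^sub>R v))) (at 0)" using d1 by simp
  have "(k has_real_derivative - 2 * ((z - a) \<bullet> v)) (at 0)"
  proof -
    have "((\<lambda>t. G (f z - t *\<^sub>R u) - a) has_derivative (\<lambda>t. - (t *\<^sub>R v))) (at 0)"
      using has_derivative_diff[OF d2 has_derivative_const[of a]] by simp
    from has_derivative_inner[OF this this] show ?thesis
      unfolding has_field_derivative_def k_def
      by (rule has_derivative_eq_rhs) (simp add: fun_eq_iff GF U(2) inner_commute)
  qed
  from DERIV_neg_dec_right[OF this] out
  obtain d where d: "d > 0" "\<And>t. 0 < t \<Longrightarrow> t < d \<Longrightarrow> k t < k 0" by auto
  have "eventually (\<lambda>t. k t < k 0) (at_right 0)"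
    using d by (auto simp: eventually_at_right)
  with e1 show ?thesis
  proof eventually_elim
    case (elim t)
    have "norm (G (f z - t *\<^sub>R u) - a) < norm (z - a)"
      using elim(2) unfolding k_def norm_lt by (simp add: GF U(2))
    then have "G (f z - t *\<^sub>R u) \<in> ball a r" using z by (simp add: dist_norm norm_minus_commute)
    moreover have "G (f z - t *\<^sub>R u) \<in> U" "f (G (f z - t *\<^sub>R u)) = f z - t *\<^sub>R u"
      using elim(1) unfolding G_def by (auto intro: inv_into_into f_inv_into_f)
    ultimately show ?case by (metis IntI imageI)
  qed
qed

section \<open>Univalence\<close>

text \<open>
  The decomposition \<open>f = h + cnj g\<close> is part of the locale because all later estimates are
  in terms of \<open>h\<close> and \<open>g\<close>; \<open>dilatation\<close> expresses that \<open>f\<close> preserves the orientation.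
\<close>

locale absolutely_convex_map =
  fixes f h g :: "complex \<Rightarrow> complex"
  assumes holo_h: "h holomorphic_on ball 0 1" and holo_g: "g holomorphic_on ball 0 1"
    and f_eq: "\<And>z. z \<in> ball 0 1 \<Longrightarrow> f z = h z + cnj (g z)"
    and dilatation: "\<And>z. z \<in> ball 0 1 \<Longrightarrow> norm (deriv g z) < norm (deriv h z)"
    and loc_univ: "locally_univalent f"
    and convex_discs: "\<And>a r. 0 < r \<Longrightarrow> r < 1 - norm a \<Longrightarrow> convex (f ` ball a r)"
begin

lemma der_f: "z \<in> ball 0 1 \<Longrightarrow> (f has_derivative real_linear (deriv h z) (deriv g z)) (at z)"
  by (rule harmonic_has_derivative[OF holo_h holo_g f_eq])

lemma cont_f: "continuous_on (ball 0 1) f"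
  using der_f has_derivative_continuous by (blast intro: continuous_at_imp_continuous_on)

lemma local_inj:
  assumes "z \<in> ball 0 1"
  obtains U where "open U" "z \<in> U" "U \<subseteq> ball 0 1" "inj_on f U"
  using loc_univ assms unfolding locally_univalent_def by blast

text \<open>
  If a boundary value were also taken at an interior point \<open>y\<close>, then by invariance of domain all
  nearby values would be taken near \<open>y\<close>, and points of the disc close to \<open>z\<close> would repeat them.
\<close>

lemma boundary_value_notin_image:
  assumes inj: "inj_on f (ball 0 r)" and r: "0 < r" "r < 1" and z: "norm z = r"
  shows "f z \<notin> f ` ball 0 r"
proof
  assume "f z \<in> f ` ball 0 r"
  then obtain y where y: "y \<in> ball 0 r" "f y = f z" by auto
  with z have "y \<noteq> z" by auto
  then obtain U V where UV: "open U" "open V" "y \<in> U" "z \<in> V" "U \<inter> V = {}"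
    using hausdorff by metis
  let ?U = "U \<inter> ball 0 r"
  have "open (f ` ?U)"
    using UV(1) r by (intro invariance_of_domain continuous_on_subset[OF cont_f] inj_on_subset[OF inj]) auto
  have "isCont f z" using der_f[of z] z r by (auto intro: has_derivative_continuous)
  then have lim: "(f \<longlongrightarrow> f z) (at z within ball 0 r)"
    using isCont_def tendsto_within_subset by blast
  have ev: "eventually (\<lambda>x. f x \<in> f ` ?U) (at z within ball 0 r)"
    using topological_tendstoD[OF lim \<open>open (f ` ?U)\<close>] y UV(3) by (metis IntI imageI)
  have "eventually (\<lambda>x. x \<in> V \<and> x \<in> ball 0 r) (at z within ball 0 r)"
    using UV(2,4) by (auto simp: eventually_at_topological)
  with ev have "eventually (\<lambda>x. False) (at z within ball 0 r)"
  proof eventually_elim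
    case (elim x)
    then obtain x' where "x' \<in> ?U" "f x' = f x" by auto
    then have "x' = x" using inj elim(2) by (simp add: inj_on_def)
    then show ?case using \<open>x' \<in> ?U\<close> elim(2) UV(5) by blast
  qed
  moreover have "z islimpt ball 0 r" using z r by (simp add: islimpt_ball)
  ultimately show False by (simp add: trivial_limit_def[symmetric] trivial_limit_within)
qed

text \<open>
  The only place where convexity enters the proof of univalence. A line supporting the image at a
  common value of two boundary points serves both of them, so one short normal segment is covered
  from neighbourhoods of both points.
\<close>

lemma inj_on_closed_disc:
  assumes inj: "inj_on f (ball 0 r)" and r: "0 < r" "r < 1"
  shows "inj_on f (cball 0 r)"
proof (rule inj_onI, rule ccontr)
  fix x y assume xy: "x \<in> cball 0 r" "y \<in> cball 0 r" "f x = f y" "x \<noteq> y"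
  note nb = boundary_value_notin_image[OF inj r]
  have "norm x = r \<or> norm y = r" using xy inj by (force simp: inj_on_def)
  then have nxy: "norm x = r" "norm y = r"
    using nb[of x] nb[of y] xy by (metis imageI mem_ball_0 mem_cball_0 order_le_less)+
  have xyb: "x \<in> ball 0 1" "y \<in> ball 0 1" using nxy r by auto
  obtain u where u: "u \<noteq> 0" "\<And>w. w \<in> f ` ball 0 r \<Longrightarrow> u \<bullet> w \<le> u \<bullet> f x"
  proof (rule separating_point)
    show "convex (f ` ball 0 r)" using convex_discs[of r 0] r by simp
    show "f ` ball 0 r \<noteq> {}" using r by simp
    show "f x \<notin> f ` ball 0 r" by (rule nb[OF nxy(1)])
  qed blast
  obtain A B where AB: "open A" "open B" "x \<in> A" "y \<in> B" "A \<inter> B = {}"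
    using hausdorff[OF xy(4)] by blast
  obtain U where U: "open U" "x \<in> U" "U \<subseteq> ball 0 1" "inj_on f U" using local_inj[OF xyb(1)] .
  obtain V where V: "open V" "y \<in> V" "V \<subseteq> ball 0 1" "inj_on f V" using local_inj[OF xyb(2)] .
  have "eventually (\<lambda>t. f x - t *\<^sub>R u \<in> f ` ((A \<inter> U) \<inter> ball 0 r)) (at_right 0)"
    by (rule boundary_image_covers_normal_segment[OF _ _ _ _ der_f[OF xyb(1)] dilatation[OF xyb(1)] _ _ u(1) r(1)])
       (use U AB nxy u(2) in \<open>auto intro: inj_on_subset[OF U(4)] continuous_on_subset[OF cont_f]\<close>)
  moreover have "eventually (\<lambda>t. f y - t *\<^sub>R u \<in> f ` ((B \<inter> V) \<inter> ball 0 r)) (at_right 0)"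
    by (rule boundary_image_covers_normal_segment[OF _ _ _ _ der_f[OF xyb(2)] dilatation[OF xyb(2)] _ _ u(1) r(1)])
       (use V AB nxy u(2) xy(3) in \<open>auto intro: inj_on_subset[OF V(4)] continuous_on_subset[OF cont_f]\<close>)
  ultimately have "eventually (\<lambda>t. f x - t *\<^sub>R u \<in> f ` ((A \<inter> U) \<inter> ball 0 r) \<and>
      f y - t *\<^sub>R u \<in> f ` ((B \<inter> V) \<inter> ball 0 r)) (at_right (0::real))"
    by (rule eventually_conj)
  then obtain t where t: "f x - t *\<^sub>R u \<in> f ` ((A \<inter> U) \<inter> ball 0 r)"
      "f y - t *\<^sub>R u \<in> f ` ((B \<inter> V) \<inter> ball 0 r)"
    using eventually_happens'[OF trivial_limit_at_right_real] by blast
  obtain s where s: "s \<in> A" "s \<in> ball 0 r" "f s = f x - t *\<^sub>R u" using t(1) by auto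
  obtain s' where s': "s' \<in> B" "s' \<in> ball 0 r" "f s' = f y - t *\<^sub>R u" using t(2) by auto
  have "s = s'" using inj s s' xy(3) by (simp add: inj_on_def)
  then show False using s s' AB(5) by blast
qed

text \<open>
  Pairs of distinct points with equal values in shrinking discs would accumulate at a single point
  of the closed disc, where \<open>f\<close> is locally injective.
\<close>

lemma inj_on_larger_disc:
  assumes inj: "inj_on f (cball 0 r)" and r: "0 < r" "r < 1"
  obtains s where "r < s" "s < 1" "inj_on f (ball 0 s)"
proof (rule ccontr)
  assume no: "\<not> thesis"
  define R where "R n = r + ((1 - r) / 2) / Suc n" for n
  have R: "r < R n" "R n \<le> (1 + r) / 2" "R n < 1" for n
  proof -
    have "((1 - r) / 2) / Suc n \<le> ((1 - r) / 2) / 1" using r by (intro divide_left_mono) auto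
    then show "R n \<le> (1 + r) / 2" unfolding R_def by (simp add: field_simps)
    then show "R n < 1" using r by simp
    show "r < R n" unfolding R_def using r by simp
  qed
  have "\<exists>z. fst z \<in> ball 0 (R n) \<and> snd z \<in> ball 0 (R n) \<and> f (fst z) = f (snd z) \<and> fst z \<noteq> snd z" for n
    using no R[of n] that[of "R n"] unfolding inj_on_def by fastforce
  then obtain Z where Z: "\<And>n. fst (Z n) \<in> ball 0 (R n) \<and> snd (Z n) \<in> ball 0 (R n) \<and>
      f (fst (Z n)) = f (snd (Z n)) \<and> fst (Z n) \<noteq> snd (Z n)" by metis
  define K where "K = cball (0::complex) ((1 + r) / 2)"
  have "compact (K \<times> K)" unfolding K_def by (intro compact_Times compact_cball)
  moreover have "Z n \<in> K \<times> K" for n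
    using Z[of n] R[of n] unfolding K_def by (auto simp: mem_Times_iff)
  ultimately obtain l s where l: "l \<in> K \<times> K" "strict_mono s" "(Z \<circ> s) \<longlonglongrightarrow> l"
    unfolding compact_def by blast
  have l1: "(\<lambda>n. fst (Z (s n))) \<longlonglongrightarrow> fst l" and l2: "(\<lambda>n. snd (Z (s n))) \<longlonglongrightarrow> snd l"
    using tendsto_fst[OF l(3)] tendsto_snd[OF l(3)] by (simp_all add: o_def)
  have "R \<longlonglongrightarrow> r + 0" unfolding R_def
    by (intro tendsto_add tendsto_const LIMSEQ_Suc lim_const_over_n)
  then have Rs: "(\<lambda>n. R (s n)) \<longlonglongrightarrow> r"
    using LIMSEQ_subseq_LIMSEQ[OF _ l(2)] by (simp add: o_def)
  have n1: "norm (fst l) \<le> r"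
    by (rule LIMSEQ_le[OF tendsto_norm[OF l1] Rs]) (use Z in \<open>auto intro: less_imp_le\<close>)
  have n2: "norm (snd l) \<le> r"
    by (rule LIMSEQ_le[OF tendsto_norm[OF l2] Rs]) (use Z in \<open>auto intro: less_imp_le\<close>)
  have b: "fst l \<in> ball 0 1" "snd l \<in> ball 0 1" using n1 n2 r by auto
  have "(\<lambda>n. f (fst (Z (s n)))) \<longlonglongrightarrow> f (fst l)"
    using isCont_tendsto_compose[OF _ l1] has_derivative_continuous[OF der_f[OF b(1)]] by blast
  moreover have "(\<lambda>n. f (snd (Z (s n)))) \<longlonglongrightarrow> f (snd l)"
    using isCont_tendsto_compose[OF _ l2] has_derivative_continuous[OF der_f[OF b(2)]] by blast
  ultimately have "f (fst l) = f (snd l)"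
    using Z LIMSEQ_unique by auto
  then have eq: "fst l = snd l" using inj n1 n2 by (auto simp: inj_on_def)
  obtain U where U: "open U" "fst l \<in> U" "U \<subseteq> ball 0 1" "inj_on f U" using local_inj[OF b(1)] .
  have "eventually (\<lambda>n. fst (Z (s n)) \<in> U) sequentially" "eventually (\<lambda>n. snd (Z (s n)) \<in> U) sequentially"
    using topological_tendstoD[OF l1 U(1,2)] topological_tendstoD[OF l2 U(1)] U(2) eq by auto
  then have "eventually (\<lambda>n::nat. False) sequentially"
    by eventually_elim (use Z U(4) in \<open>auto simp: inj_on_def\<close>)
  then show False by simp
qed

lemma univalent: "inj_on f (ball 0 1)"
proof -
  define S where "S = {r. 0 < r \<and> r \<le> 1 \<and> inj_on f (ball 0 r)}"
  obtain U where U: "open U" "0 \<in> U" "U \<subseteq> ball 0 1" "inj_on f U"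
    using local_inj[of 0] by auto
  obtain e where e: "e > 0" "ball 0 e \<subseteq> U" using U(1,2) openE by blast
  have "ball 0 (min e 1) \<subseteq> U" using e(2) subset_ball[of "min e 1" e 0] by auto
  then have "min e 1 \<in> S" unfolding S_def using e(1) inj_on_subset[OF U(4)] by auto
  then have ne: "S \<noteq> {}" by blast
  have bdd: "bdd_above S" unfolding S_def by (auto intro: bdd_aboveI[of _ 1])
  define m where "m = Sup S"
  have m: "0 < m" "m \<le> 1"
  proof -
    show "0 < m" using cSup_upper[OF \<open>min e 1 \<in> S\<close> bdd] e unfolding m_def by auto
    show "m \<le> 1" unfolding m_def by (rule cSup_least[OF ne]) (auto simp: S_def)
  qed
  have inj: "inj_on f (ball 0 m)"
  proof (rule inj_onI)
    fix x y assume xy: "x \<in> ball 0 m" "y \<in> ball 0 m" "f x = f y"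
    then have "max (norm x) (norm y) < Sup S" unfolding m_def by auto
    then obtain r where "r \<in> S" "max (norm x) (norm y) < r" using less_cSupE ne by blast
    then show "x = y" using xy(3) unfolding S_def inj_on_def by auto
  qed
  show ?thesis
  proof (cases "m = 1")
    case True
    with inj show ?thesis by simp
  next
    case False
    with m have "m < 1" by simp
    obtain s where s: "m < s" "s < 1" "inj_on f (ball 0 s)"
      using inj_on_larger_disc[OF inj_on_closed_disc[OF inj m(1) \<open>m < 1\<close>] m(1) \<open>m < 1\<close>] .
    then have "s \<in> S" using m unfolding S_def by auto
    then show ?thesis using cSup_upper[OF _ bdd, of s] s unfolding m_def by auto
  qed
qed

end

section \<open>Curvature of image circles and the Jacobian inequality\<close>

lemma second_derivative_at_max:
  fixes k k' :: "real \<Rightarrow> real"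
  assumes d1: "\<And>t. (k has_real_derivative k' t) (at t)"
    and d2: "(k' has_real_derivative c) (at 0)" and max: "\<And>t. k t \<le> k 0"
  shows "k' 0 = 0" "c \<le> 0"
proof -
  show 0: "k' 0 = 0"
    using DERIV_local_max[OF d1[of 0], of 1] max by auto
  show "c \<le> 0"
  proof (rule ccontr)
    assume "\<not> c \<le> 0"
    then obtain d where d: "d > 0" "\<And>t. 0 < t \<Longrightarrow> t < d \<Longrightarrow> 0 < k' t"
      using DERIV_pos_inc_right[OF d2] 0 by auto
    have "k 0 < k (d / 2)"
    proof (rule DERIV_pos_imp_increasing_open[of 0 "d / 2" k])
      show "\<exists>y. (k has_real_derivative y) (at x) \<and> y > 0" if "0 < x" "x < d / 2" for x
        using d1[of x] d(2)[of x] that by auto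
      show "continuous_on {0..d/2} k"
        by (meson d1 DERIV_isCont continuous_at_imp_continuous_on)
    qed (use d in simp)
    with max[of "d / 2"] show False by simp
  qed
qed

text \<open>
  \<open>F1\<close> and \<open>F2\<close> are the first two derivatives of a plane curve at a point where it touches the line
  orthogonal to \<open>u\<close> from the side opposite to \<open>u\<close>, and \<open>W\<close> points away from the enclosed region. The
  tangent is a multiple of \<open>\<i> u\<close>, the orientation of \<open>W\<close> and \<open>F1\<close> makes the multiple positive, and
  then the sign of \<open>u \<bullet> F2\<close> is opposite to that of the curvature.
\<close>

lemma turning_left_at_support:
  fixes u F1 F2 W :: complex
  assumes "u \<noteq> 0" "u \<bullet> F1 = 0" "u \<bullet> F2 \<le> 0" "u \<bullet> W \<ge> 0" "Im (cnj W * F1) > 0"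
  shows "Im (cnj F1 * F2) \<ge> 0"
proof -
  define l where "l = Re u * Im F1 - Im u * Re F1"
  define n where "n = (Re F1)\<^sup>2 + (Im F1)\<^sup>2"
  have D: "Re W * Im F1 - Im W * Re F1 > 0" using assms(5) by simp
  have o: "Re u * Re F1 + Im u * Im F1 = 0" using assms(2) by (simp add: inner_complex_def)
  have "F1 \<noteq> 0" using assms(5) by auto
  then have n: "n > 0" unfolding n_def by (simp add: complex_neq_0)
  have "n * Re u = l * Im F1 + Re F1 * (Re u * Re F1 + Im u * Im F1)"
    unfolding n_def l_def by (simp add: algebra_simps power2_eq_square)
  then have u1: "n * Re u = l * Im F1" using o by simp
  have "n * Im u = - l * Re F1 + Im F1 * (Re u * Re F1 + Im u * Im F1)"
    unfolding n_def l_def by (simp add: algebra_simps power2_eq_square)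
  then have u2: "n * Im u = - l * Re F1" using o by simp
  have in_u: "n * (u \<bullet> v) = l * (Re v * Im F1 - Im v * Re F1)" for v
  proof -
    have "n * (u \<bullet> v) = (n * Re u) * Re v + (n * Im u) * Im v"
      by (simp add: inner_complex_def algebra_simps)
    then show ?thesis unfolding u1 u2 by (simp add: algebra_simps)
  qed
  have "l \<noteq> 0" using u1 u2 n assms(1) by (auto simp: complex_eq_iff)
  have "l * (Re W * Im F1 - Im W * Re F1) \<ge> 0"
    using in_u[of W] n assms(4) by (metis mult_nonneg_nonneg less_imp_le)
  with D \<open>l \<noteq> 0\<close> have l: "l > 0" by (simp add: zero_le_mult_iff)
  have "l * (Re F2 * Im F1 - Im F2 * Re F1) \<le> 0"
    using in_u[of F2] n assms(3) by (metis mult_nonneg_nonpos less_imp_le)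
  with l have "Re F2 * Im F1 - Im F2 * Re F1 \<le> 0" by (simp add: mult_le_0_iff)
  then show ?thesis by (simp add: mult.commute)
qed

text \<open>
  The left side is \<open>Im (cnj F' F'')\<close> for \<open>F t = f (a + z exp (\<i> t))\<close> at \<open>t = 0\<close>, where \<open>p\<close>, \<open>P\<close> are the
  first two derivatives of \<open>h\<close> and \<open>q\<close>, \<open>Q\<close> those of \<open>g\<close>, at \<open>a + z\<close>.
\<close>

lemma curvature_of_image_circle:
  fixes p q P Q z :: complex
  shows "Im (cnj (\<i> * p * z + cnj (\<i> * q * z)) * (- (P * z\<^sup>2 + p * z) + cnj (- (Q * z\<^sup>2 + q * z)))) =
    ((cmod p)\<^sup>2 - (cmod q)\<^sup>2) * (cmod z)\<^sup>2 + (cmod z)\<^sup>2 * Re ((cnj p * P - cnj q * Q) * z)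
      - Re ((q * P - p * Q) * z ^ 3)"
  unfolding cmod_power2
  by (simp add: power2_eq_square power3_eq_cube algebra_simps)

lemma orientation_real_linear:
  "Im (cnj (real_linear p q v) * real_linear p q (\<i> * v)) = ((cmod p)\<^sup>2 - (cmod q)\<^sup>2) * (cmod v)\<^sup>2"
  unfolding real_linear_def cmod_power2 by (simp add: power2_eq_square algebra_simps)

context absolutely_convex_map begin

definition jac :: "complex \<Rightarrow> real" where
  "jac z = (cmod (deriv h z))\<^sup>2 - (cmod (deriv g z))\<^sup>2"

definition jac_z :: "complex \<Rightarrow> complex" where
  "jac_z z = cnj (deriv h z) * deriv (deriv h) z - cnj (deriv g z) * deriv (deriv g) z"

definition wronski :: "complex \<Rightarrow> complex" where
  "wronski z = deriv g z * deriv (deriv h) z - deriv h z * deriv (deriv g) z"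

lemma jac_pos: "z \<in> ball 0 1 \<Longrightarrow> jac z > 0"
  unfolding jac_def using dilatation by (simp add: power_strict_mono)

text \<open>
  By univalence \<open>f z\<close> does not lie in the convex image of the disc, so a line through it
  supports the image. The position of the bounding curve relative to that line has a maximum at \<open>z\<close>,
  and the second-order condition there is the stated inequality.
\<close>

lemma disc_inequality:
  assumes z: "norm (z - a) = r" and r: "r > 0" "norm a + r < 1"
  shows "jac z * r\<^sup>2 + r\<^sup>2 * Re (jac_z z * (z - a)) - Re (wronski z * (z - a) ^ 3) \<ge> 0"
proof -
  define \<zeta> where "\<zeta> = z - a"
  have sub: "cball a r \<subseteq> ball 0 1"
  proof
    fix x assume "x \<in> cball a r"
    then have "norm (x - a) \<le> r" by (simp add: dist_norm norm_minus_commute)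
    with norm_triangle_sub[of x a] r show "x \<in> ball 0 1" by simp
  qed
  have zb: "z \<in> cball a r" using z by (simp add: dist_norm norm_minus_commute)
  then have z1: "z \<in> ball 0 1" using sub by blast
  define p q P Q where "p = deriv h z" and "q = deriv g z" and "P = deriv (deriv h) z" and "Q = deriv (deriv g) z"
  note defs = this
  have "f z \<notin> f ` ball a r"
  proof
    assume "f z \<in> f ` ball a r"
    then obtain y where y: "y \<in> ball a r" "f y = f z" by auto
    moreover have "y \<in> ball 0 1" using y(1) sub ball_subset_cball[of a r] by blast
    ultimately have "y = z" using univalent z1 by (simp add: inj_on_def)
    with y z show False by (simp add: dist_norm norm_minus_commute)
  qed
  then obtain u where u: "u \<noteq> 0" "\<And>w. w \<in> f ` ball a r \<Longrightarrow> u \<bullet> w \<le> u \<bullet> f z"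
    using separating_point[of "f ` ball a r" "f z"] convex_discs[of r a] r by auto
  have sup: "u \<bullet> f x \<le> u \<bullet> f z" if "x \<in> cball a r" for x
  proof (rule continuous_le_on_closure[of "ball a r" "\<lambda>x. u \<bullet> f x" x])
    show "continuous_on (closure (ball a r)) (\<lambda>x. u \<bullet> f x)"
      using r sub by (intro continuous_intros continuous_on_subset[OF cont_f]) auto
  qed (use that u(2) r in auto)
  define c where "c w = a + \<zeta> * exp (\<i> * w)" for w :: complex
  have c: "c (of_real t) \<in> cball a r" for t
    using z unfolding c_def \<zeta>_def by (simp add: dist_norm norm_mult)
  have c1: "c (of_real t) \<in> ball 0 1" for t using c sub by blast
  have c0: "c 0 = z" unfolding c_def \<zeta>_def by simp
  have dc: "(c has_field_derivative (\<zeta> * exp (\<i> * w) * \<i>)) (at w)" for w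
    unfolding c_def by (auto intro!: derivative_eq_intros)
  have first: "((\<lambda>t. k (c (of_real t))) has_vector_derivative
       (deriv k (c (of_real t)) * (\<zeta> * exp (\<i> * of_real t) * \<i>))) (at t)"
    if k: "k holomorphic_on ball 0 1" for k :: "complex \<Rightarrow> complex" and t :: real
    by (rule has_vector_derivative_real_field)
      (rule DERIV_chain2[OF holomorphic_derivI[OF k open_ball c1] dc])
  have second: "((\<lambda>t. deriv k (c (of_real t)) * (\<zeta> * exp (\<i> * of_real t) * \<i>)) has_vector_derivative
       - (deriv (deriv k) z * \<zeta>\<^sup>2 + deriv k z * \<zeta>)) (at 0)"
    if k: "k holomorphic_on ball 0 1" for k :: "complex \<Rightarrow> complex"
  proof -
    have k': "deriv k holomorphic_on ball 0 1" using k by (rule holomorphic_deriv) simp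
    have "((\<lambda>w. deriv k (c w)) has_field_derivative (deriv (deriv k) z * (\<zeta> * \<i>))) (at (of_real 0))"
      using DERIV_chain2[OF holomorphic_derivI[OF k' open_ball c1[of 0]] dc[of "of_real 0"]] c0 by simp
    then have "((\<lambda>w. deriv k (c w) * (\<zeta> * exp (\<i> * w) * \<i>)) has_field_derivative
        - (deriv (deriv k) z * \<zeta>\<^sup>2 + deriv k z * \<zeta>)) (at (of_real 0))"
      by (auto intro!: derivative_eq_intros simp: c0 power2_eq_square algebra_simps)
    from has_vector_derivative_real_field[OF this] show ?thesis by simp
  qed
  define k where "k t = u \<bullet> f (c (of_real t))" for t :: real
  define k' where "k' t = u \<bullet> (deriv h (c (of_real t)) * (\<zeta> * exp (\<i> * of_real t) * \<i>) +
      cnj (deriv g (c (of_real t)) * (\<zeta> * exp (\<i> * of_real t) * \<i>)))" for t :: real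
  define F1 where "F1 = \<i> * p * \<zeta> + cnj (\<i> * q * \<zeta>)"
  define F2 where "F2 = - (P * \<zeta>\<^sup>2 + p * \<zeta>) + cnj (- (Q * \<zeta>\<^sup>2 + q * \<zeta>))"
  note inner_der = bounded_linear.has_vector_derivative[OF bounded_linear_inner_right[of u]]
  have d1: "(k has_real_derivative k' t) (at t)" for t
    unfolding k_def k'_def has_real_derivative_iff_has_vector_derivative f_eq[OF c1]
    by (intro inner_der has_vector_derivative_add has_vector_derivative_cnj first holo_h holo_g)
  have d2: "(k' has_real_derivative u \<bullet> F2) (at 0)"
    unfolding F2_def k'_def has_real_derivative_iff_has_vector_derivative defs
    by (intro inner_der has_vector_derivative_add has_vector_derivative_cnj second holo_h holo_g)
  have "k t \<le> k 0" for t unfolding k_def using sup[OF c, of t] c0 by simp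
  note crit = second_derivative_at_max[OF d1 d2 this]
  have F1: "k' 0 = u \<bullet> F1"
    unfolding k'_def F1_def defs by (simp add: c0 mult_ac)
  have W: "u \<bullet> real_linear p q \<zeta> \<ge> 0"
  proof -
    have "u \<bullet> real_linear p q (- \<zeta>) \<le> 0"
      unfolding defs
    proof (rule inward_directional_derivative_le_0[OF der_f[OF z1] z])
      have "\<zeta> \<bullet> \<zeta> > 0" unfolding \<zeta>_def using z r by auto
      then show "(z - a) \<bullet> (- \<zeta>) < 0" unfolding \<zeta>_def inner_minus_right by simp
    qed (use sup in auto)
    then show ?thesis by (simp add: real_linear_def inner_diff_right inner_add_right)
  qed
  have "real_linear p q (\<i> * \<zeta>) = F1" unfolding real_linear_def F1_def by (simp add: mult_ac)
  then have "Im (cnj (real_linear p q \<zeta>) * F1) = jac z * r\<^sup>2"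
    using orientation_real_linear[of p q \<zeta>] z unfolding jac_def defs \<zeta>_def by simp
  then have "Im (cnj (real_linear p q \<zeta>) * F1) > 0"
    using jac_pos[OF z1] r by simp
  from turning_left_at_support[OF u(1) _ crit(2) W this] crit(1) F1
  have "Im (cnj F1 * F2) \<ge> 0" by simp
  then show ?thesis
    unfolding F1_def F2_def curvature_of_image_circle
    unfolding defs jac_def jac_z_def wronski_def \<zeta>_def z by simp
qed

text \<open>
  The discs with \<open>z\<close> on the boundary and centre \<open>z - r e\<close> lie in the unit disc for all
  \<open>r < m = (1 - \<bar>z\<bar>\<^sup>2) / (2 (1 - Re (cnj z e)))\<close>; at \<open>r = m\<close> the disc touches the unit circle. That limit
  carries the most information, because the inequality is affine in \<open>r\<close> and holds at \<open>r = 0\<close>.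
\<close>

lemma horodisc_inequality:
  assumes z: "z \<in> ball 0 1" and e: "norm e = 1"
  shows "2 * jac z * (1 - Re (cnj z * e)) + (1 - (norm z)\<^sup>2) * (Re (jac_z z * e) - Re (wronski z * e ^ 3)) \<ge> 0"
proof -
  define X where "X = Re (jac_z z * e) - Re (wronski z * e ^ 3)"
  define d where "d = 1 - Re (cnj z * e)"
  have nz: "norm z < 1" using z by simp
  have "Re (cnj z * e) \<le> norm (cnj z * e)" by (rule complex_Re_le_cmod)
  also have "\<dots> = norm z" using e by (simp add: norm_mult)
  finally have d: "d \<ge> 1 - norm z" unfolding d_def by simp
  have d0: "d > 0" using d nz by simp
  define m where "m = (1 - (norm z)\<^sup>2) / (2 * d)"
  have D: "1 - (norm z)\<^sup>2 > 0" using nz by (simp add: power_less_one_iff)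
  have m0: "m > 0" unfolding m_def using D d0 by simp
  have "1 - (norm z)\<^sup>2 = (1 - norm z) * (1 + norm z)" by (simp add: algebra_simps power2_eq_square)
  also have "\<dots> \<le> d * (1 + norm z)" using d by (intro mult_right_mono) auto
  also have "\<dots> \<le> d * 2" using d0 nz by (intro mult_left_mono) auto
  finally have m1: "m \<le> 1" unfolding m_def using d0 by (simp add: field_simps)
  have *: "jac z + r * X \<ge> 0" if r: "0 < r" "r < m" for r
  proof -
    define a where "a = z - of_real r * e"
    have za: "z - a = of_real r * e" unfolding a_def by simp
    have nza: "norm (z - a) = r" unfolding za using r e by (simp add: norm_mult)
    have "(norm a)\<^sup>2 = (norm z)\<^sup>2 - 2 * r * Re (cnj z * e) + r\<^sup>2 * (norm e)\<^sup>2"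
      unfolding a_def cmod_power2 by (simp add: power2_eq_square algebra_simps)
    moreover have "r * (2 * d) < 1 - (norm z)\<^sup>2"
      using r(2) d0 unfolding m_def by (simp add: field_simps)
    ultimately have "(norm a)\<^sup>2 < (1 - r)\<^sup>2"
      using e unfolding d_def by (simp add: power2_eq_square algebra_simps)
    then have "norm a < 1 - r" by (rule power2_less_imp_less) (use r m1 in auto)
    then have "jac z * r\<^sup>2 + r\<^sup>2 * Re (jac_z z * (z - a)) - Re (wronski z * (z - a) ^ 3) \<ge> 0"
      by (intro disc_inequality[OF nza]) (use r in auto)
    moreover have "jac z * r\<^sup>2 + r\<^sup>2 * Re (jac_z z * (z - a)) - Re (wronski z * (z - a) ^ 3) = r\<^sup>2 * (jac z + r * X)"
    proof -
      have "jac_z z * (z - a) = of_real r * (jac_z z * e)"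
        "wronski z * (z - a) ^ 3 = of_real (r ^ 3) * (wronski z * e ^ 3)"
        unfolding za by (simp_all add: power_mult_distrib)
      moreover have "Re (of_real c * w) = c * Re w" for c w by simp
      ultimately have "Re (jac_z z * (z - a)) = r * Re (jac_z z * e)"
        "Re (wronski z * (z - a) ^ 3) = r ^ 3 * Re (wronski z * e ^ 3)"
        by (simp_all only:)
      then show ?thesis unfolding X_def by (simp only:) (simp add: power2_eq_square power3_eq_cube algebra_simps)
    qed
    ultimately have "r\<^sup>2 * (jac z + r * X) \<ge> 0" by (simp only:)
    then show ?thesis using r by (simp add: zero_le_mult_iff)
  qed
  have "jac z + m * X \<ge> 0"
  proof (rule tendsto_lowerbound[of "\<lambda>r. jac z + r * X" _ "at_left m"])
    show "((\<lambda>r. jac z + r * X) \<longlongrightarrow> jac z + m * X) (at_left m)"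
      by (intro tendsto_intros)
    show "eventually (\<lambda>r. 0 \<le> jac z + r * X) (at_left m)"
      using * m0 by (auto simp: eventually_at_left)
  qed simp
  then have "2 * d * (jac z + m * X) \<ge> 0" using d0 by simp
  also have "2 * d * (jac z + m * X) = 2 * jac z * d + (1 - (norm z)\<^sup>2) * X"
    unfolding m_def using d0 by (simp add: field_simps)
  finally show ?thesis unfolding d_def X_def .
qed

text \<open>
  Averaging over two directions eliminates the unknown Wronskian: \<open>1 + Re (A e) + Re (C e\<^sup>3) \<ge> 0\<close> for
  all unit vectors \<open>e\<close> forces \<open>\<bar>A\<bar> \<le> 2 / sqrt 3\<close>.
\<close>

lemma jacobian_differential_inequality:
  assumes z: "z \<in> ball 0 1"
  shows "norm ((1 - (norm z)\<^sup>2) * jac_z z - 2 * cnj z * jac z) \<le> 4 / sqrt 3 * jac z"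
proof -
  define B where "B = (1 - (norm z)\<^sup>2) * jac_z z - 2 * cnj z * jac z"
  have key: "2 * jac z + Re (B * e) \<ge> (1 - (norm z)\<^sup>2) * Re (wronski z * e ^ 3)" if "norm e = 1" for e
  proof -
    have "B * e = of_real (1 - (norm z)\<^sup>2) * (jac_z z * e) - of_real (2 * jac z) * (cnj z * e)"
      unfolding B_def by (simp add: algebra_simps)
    moreover have "Re (of_real c * w) = c * Re w" for c w by simp
    ultimately have "Re (B * e) = (1 - (norm z)\<^sup>2) * Re (jac_z z * e) - 2 * jac z * Re (cnj z * e)"
      by (simp only: minus_complex.simps(1))
    with horodisc_inequality[OF z that] show ?thesis by (simp add: algebra_simps)
  qed
  obtain w where w: "norm w = 1" "B * w = - of_real (norm B)"
  proof (cases "B = 0")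
    case True
    then show ?thesis using that[of 1] by simp
  next
    case False
    have "B * cnj B = of_real (norm B) * of_real (norm B)"
      by (simp add: complex_norm_square[symmetric] power2_eq_square)
    then show ?thesis using that[of "- cnj B / of_real (norm B)"] False
      by (simp add: norm_divide)
  qed
  \<comment> \<open>\<open>x\<close> and \<open>cnj x\<close> are \<open>exp (\<plusminus> \<i> \<pi>/6)\<close>, with cubes \<open>\<plusminus> \<i>\<close>\<close>
  define x where "x = Complex (sqrt 3 / 2) (1 / 2)"
  have x: "norm x = 1" "x ^ 3 = \<i>" "x + cnj x = of_real (sqrt 3)"
    unfolding x_def by (simp_all add: cmod_def power3_eq_cube complex_eq_iff power2_eq_square field_simps)
  have "Re (wronski z * (w * x) ^ 3) + Re (wronski z * (w * cnj x) ^ 3) = 0"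
    by (simp add: power_mult_distrib x complex_cnj_power[symmetric] del: complex_cnj_power)
  moreover have "Re (B * (w * x)) + Re (B * (w * cnj x)) = Re (B * w * (x + cnj x))"
    by (simp add: algebra_simps)
  moreover have "Re (B * w * (x + cnj x)) = - sqrt 3 * norm B"
    unfolding w x by simp
  moreover have "2 * jac z + Re (B * (w * x)) \<ge> (1 - (norm z)\<^sup>2) * Re (wronski z * (w * x) ^ 3)"
    "2 * jac z + Re (B * (w * cnj x)) \<ge> (1 - (norm z)\<^sup>2) * Re (wronski z * (w * cnj x) ^ 3)"
    by (intro key; simp add: norm_mult w x)+
  moreover have "(1 - (norm z)\<^sup>2) * Re (wronski z * (w * x) ^ 3) + (1 - (norm z)\<^sup>2) * Re (wronski z * (w * cnj x) ^ 3) =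
     (1 - (norm z)\<^sup>2) * (Re (wronski z * (w * x) ^ 3) + Re (wronski z * (w * cnj x) ^ 3))"
    by (rule distrib_left[symmetric])
  ultimately have "4 * jac z - sqrt 3 * norm B \<ge> 0" by simp
  then show ?thesis unfolding B_def[symmetric] by (simp add: field_simps)
qed

end

section \<open>The comparison functions\<close>

definition weight_exponent :: real ("\<beta>") where
  "weight_exponent = 4 / sqrt 3"

definition log_weight :: "real \<Rightarrow> real" where
  "log_weight x = (\<beta> - 2) * ln (1 - x) - (\<beta> + 2) * ln (1 + x)"

text \<open>
  Normalized by \<open>weight 0 = 1\<close>, the solution of \<open>(1 - x\<^sup>2) y' = (4 x - 2 \<beta>) y\<close> on \<open>(-1, 1)\<close>. It gives the
  lower bound for the Jacobian at positive arguments and the upper bound at negative ones.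
\<close>

definition weight :: "real \<Rightarrow> real" where
  "weight x = (1 - x) powr (\<beta> - 2) / (1 + x) powr (\<beta> + 2)"

text \<open>
  The integral of \<open>52 t weight t\<close> from \<open>0\<close> to \<open>x\<close>. The factor \<open>52 = 12 (16/3) - 12\<close>
  appears because \<open>\<beta>\<^sup>2 = 16/3\<close>.
\<close>

definition weight_primitive :: "real \<Rightarrow> real" where
  "weight_primitive x = 3 - (3 * x\<^sup>2 + 8 * sqrt 3 * x + 3) *
     ((1 - x) powr (\<beta> - 1) / (1 + x) powr (\<beta> + 1))"

lemma beta_gt_2: "\<beta> > 2"
proof -
  have "sqrt 3 < sqrt 4" by (rule real_sqrt_less_mono) simp
  then show ?thesis unfolding weight_exponent_def by (simp add: field_simps)
qed

lemma sqrt_3_beta: "sqrt 3 = 3 / 4 * \<beta>" "\<beta> * \<beta> = 16 / 3"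
  unfolding weight_exponent_def by (simp_all add: field_simps)

lemma weight_exp_log:
  assumes "\<bar>x\<bar> < 1" shows "weight x = exp (log_weight x)"
  using assms unfolding weight_def log_weight_def by (auto simp: powr_def exp_diff mult.commute)

lemma log_weight_deriv:
  assumes "\<bar>x\<bar> < 1"
  shows "(log_weight has_real_derivative (4 * x - 2 * \<beta>) / (1 - x\<^sup>2)) (at x)"
proof -
  have p: "1 - x > 0" "1 + x > 0" using assms by auto
  have "(log_weight has_real_derivative (\<beta> - 2) * (- 1 / (1 - x)) - (\<beta> + 2) * (1 / (1 + x))) (at x)"
    unfolding log_weight_def using p by (auto intro!: derivative_eq_intros)
  also have "(\<beta> - 2) * (- 1 / (1 - x)) - (\<beta> + 2) * (1 / (1 + x)) =
      (- (\<beta> - 2) * (1 + x) - (\<beta> + 2) * (1 - x)) / ((1 - x) * (1 + x))"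
    using p by (simp add: divide_simps, simp add: algebra_simps)
  also have "\<dots> = (4 * x - 2 * \<beta>) / (1 - x\<^sup>2)"
    by (simp add: power2_eq_square algebra_simps)
  finally show ?thesis .
qed

lemma weight_antimono:
  assumes "-1 < x" "x \<le> y" "y < 1" shows "weight y \<le> weight x"
proof -
  have "log_weight y \<le> log_weight x"
  proof (rule DERIV_nonpos_imp_nonincreasing[OF assms(2)])
    fix t assume t: "x \<le> t" "t \<le> y"
    then have "\<bar>t\<bar> < 1" using assms by auto
    moreover have "(4 * t - 2 * \<beta>) / (1 - t\<^sup>2) \<le> 0"
      using \<open>\<bar>t\<bar> < 1\<close> beta_gt_2 by (intro divide_nonpos_pos) (auto simp: abs_square_less_1)
    ultimately show "\<exists>d. (log_weight has_real_derivative d) (at t) \<and> d \<le> 0"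
      using log_weight_deriv by blast
  qed
  then show ?thesis using assms by (simp add: weight_exp_log)
qed

lemma weight_primitive_eq:
  assumes "\<bar>x\<bar> < 1"
  shows "weight_primitive x = 3 - (3 * x\<^sup>2 + 6 * \<beta> * x + 3) * (1 - x\<^sup>2) * exp (log_weight x)"
proof -
  have p: "1 - x > 0" "1 + x > 0" using assms by auto
  have "(1 - x) powr (\<beta> - 1) = (1 - x) powr (\<beta> - 2 + 1)" by simp
  also have "\<dots> = (1 - x) powr (\<beta> - 2) * (1 - x)" unfolding powr_add using p by simp
  finally have 1: "(1 - x) powr (\<beta> - 1) = (1 - x) powr (\<beta> - 2) * (1 - x)" .
  have "(1 + x) powr (\<beta> + 2) = (1 + x) powr (\<beta> + 1 + 1)" by (simp add: add.commute)
  also have "\<dots> = (1 + x) powr (\<beta> + 1) * (1 + x)" unfolding powr_add using p by simp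
  finally have 2: "(1 + x) powr (\<beta> + 2) = (1 + x) powr (\<beta> + 1) * (1 + x)" .
  have "(1 - x) powr (\<beta> - 1) / (1 + x) powr (\<beta> + 1) = (1 - x\<^sup>2) * weight x"
  proof -
    have "1 - x\<^sup>2 = (1 - x) * (1 + x)" by (simp add: power2_eq_square algebra_simps)
    then show ?thesis unfolding weight_def 1 2 using p by simp
  qed
  then show ?thesis unfolding weight_primitive_def sqrt_3_beta(1) weight_exp_log[OF assms, symmetric]
    by simp
qed

lemma weight_primitive_deriv:
  assumes "\<bar>x\<bar> < 1"
  shows "(weight_primitive has_real_derivative 52 * x * weight x) (at x)"
proof -
  have x2: "1 - x\<^sup>2 \<noteq> 0" using assms abs_square_less_1[of x] by simp
  define e k where "e = exp (log_weight x)" and "k = (4 * x - 2 * \<beta>) / (1 - x\<^sup>2)"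
  have "(log_weight has_real_derivative k) (at x)" unfolding k_def by (rule log_weight_deriv[OF assms])
  then have "((\<lambda>x. 3 - (3 * x\<^sup>2 + 6 * \<beta> * x + 3) * (1 - x\<^sup>2) * exp (log_weight x)) has_real_derivative
      - ((6 * x + 6 * \<beta>) * (1 - x\<^sup>2) * e - (3 * x\<^sup>2 + 6 * \<beta> * x + 3) * (2 * x) * e
         + (3 * x\<^sup>2 + 6 * \<beta> * x + 3) * (1 - x\<^sup>2) * (e * k))) (at x)"
    unfolding e_def by (auto intro!: derivative_eq_intros simp: algebra_simps power2_eq_square)
  also have "(3 * x\<^sup>2 + 6 * \<beta> * x + 3) * (1 - x\<^sup>2) * (e * k)
    = (3 * x\<^sup>2 + 6 * \<beta> * x + 3) * (4 * x - 2 * \<beta>) * e" unfolding k_def using x2 by simp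
  also have "- ((6 * x + 6 * \<beta>) * (1 - x\<^sup>2) * e - (3 * x\<^sup>2 + 6 * \<beta> * x + 3) * (2 * x) * e
         + (3 * x\<^sup>2 + 6 * \<beta> * x + 3) * (4 * x - 2 * \<beta>) * e)
     = (12 * (\<beta> * \<beta>) * x - 12 * x) * e"
    by (simp add: power2_eq_square algebra_simps)
  also have "\<dots> = 52 * x * weight x" unfolding sqrt_3_beta(2) e_def weight_exp_log[OF assms] by simp
  finally show ?thesis
  proof (rule has_field_derivative_transform_within_open[of _ _ _ "{-1<..<1}"])
    show "x \<in> {-1<..<1}" using assms by auto
  qed (auto simp: weight_primitive_eq abs_if)
qed

text \<open>
  \<open>weight\<close> is decreasing, so on \<open>[s, t]\<close> it may be replaced by its value at \<open>s\<close> in the integral of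
  \<open>52 x weight x\<close>; for the reflected primitive the inequality is reversed.
\<close>

lemma weight_primitive_increment:
  assumes "0 \<le> s" "s \<le> t" "t < 1"
  shows "weight_primitive t - weight_primitive s \<le> 26 * (t\<^sup>2 - s\<^sup>2) * weight s"
    and "weight_primitive (- t) - weight_primitive (- s) \<ge> 26 * (t\<^sup>2 - s\<^sup>2) * weight (- s)"
proof -
  have "weight_primitive t - 26 * t\<^sup>2 * weight s \<le> weight_primitive s - 26 * s\<^sup>2 * weight s"
  proof (rule DERIV_nonpos_imp_nonincreasing[OF assms(2)])
    fix x assume x: "s \<le> x" "x \<le> t"
    have "((\<lambda>x. weight_primitive x - 26 * x\<^sup>2 * weight s) has_real_derivative
        52 * x * weight x - 52 * x * weight s) (at x)"
      by (rule derivative_eq_intros weight_primitive_deriv refl | use x assms in simp)+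
    moreover have "52 * x * weight x - 52 * x * weight s \<le> 0"
      using weight_antimono[of s x] x assms by (simp add: mult_left_mono)
    ultimately show "\<exists>y. ((\<lambda>x. weight_primitive x - 26 * x\<^sup>2 * weight s) has_real_derivative y) (at x) \<and> y \<le> 0"
      by blast
  qed
  then show "weight_primitive t - weight_primitive s \<le> 26 * (t\<^sup>2 - s\<^sup>2) * weight s"
    by (simp add: algebra_simps)
  have "weight_primitive (- s) - 26 * s\<^sup>2 * weight (- s) \<le> weight_primitive (- t) - 26 * t\<^sup>2 * weight (- s)"
  proof (rule DERIV_nonneg_imp_nondecreasing[OF assms(2)])
    fix x assume x: "s \<le> x" "x \<le> t"
    have "((\<lambda>x. weight_primitive (- x)) has_real_derivative 52 * (- x) * weight (- x) * (- 1)) (at x)"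
      by (rule DERIV_chain2[OF weight_primitive_deriv]) (use x assms in \<open>auto intro!: derivative_eq_intros\<close>)
    moreover have "((\<lambda>x. 26 * x\<^sup>2 * weight (- s)) has_real_derivative 52 * x * weight (- s)) (at x)"
      by (auto intro!: derivative_eq_intros)
    ultimately have "((\<lambda>x. weight_primitive (- x) - 26 * x\<^sup>2 * weight (- s)) has_real_derivative
        52 * (- x) * weight (- x) * (- 1) - 52 * x * weight (- s)) (at x)"
      by (rule DERIV_diff)
    moreover have "52 * (- x) * weight (- x) * (- 1) - 52 * x * weight (- s) \<ge> 0"
      using weight_antimono[of "- x" "- s"] x assms by (simp add: mult_left_mono)
    ultimately show "\<exists>y. ((\<lambda>x. weight_primitive (- x) - 26 * x\<^sup>2 * weight (- s)) has_real_derivative y) (at x) \<and> y \<ge> 0"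
      by blast
  qed
  then show "weight_primitive (- t) - weight_primitive (- s) \<ge> 26 * (t\<^sup>2 - s\<^sup>2) * weight (- s)"
    by (simp add: algebra_simps)
qed

section \<open>Growth of the Jacobian\<close>

context absolutely_convex_map begin

lemma jac_radial_derivative:
  assumes e: "norm e = 1" and t: "\<bar>t\<bar> < 1"
  shows "((\<lambda>t. jac (of_real t * e)) has_real_derivative 2 * Re (jac_z (of_real t * e) * e)) (at t)"
proof -
  have *: "((\<lambda>t. (cmod (deriv k (of_real t * e)))\<^sup>2) has_real_derivative
      2 * Re (cnj (deriv k (of_real t * e)) * deriv (deriv k) (of_real t * e) * e)) (at t)"
    if k: "k holomorphic_on ball 0 1" for k
  proof -
    have k': "deriv k holomorphic_on ball 0 1" using k by (rule holomorphic_deriv) simp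
    have te: "of_real t * e \<in> ball 0 1" using e t by (simp add: norm_mult)
    have 1: "((\<lambda>w. w * e) has_field_derivative e) (at (of_real t))"
      by (auto intro!: derivative_eq_intros)
    have "((\<lambda>t. deriv k (of_real t * e)) has_vector_derivative (deriv (deriv k) (of_real t * e) * e)) (at t)"
      by (rule has_vector_derivative_real_field)
         (rule DERIV_chain2[OF holomorphic_derivI[OF k' open_ball te] 1])
    then have "((\<lambda>t. deriv k (of_real t * e)) has_derivative (\<lambda>x. x *\<^sub>R (deriv (deriv k) (of_real t * e) * e))) (at t)"
      unfolding has_vector_derivative_def .
    from has_derivative_inner[OF this this] show ?thesis
      unfolding has_field_derivative_def power2_norm_eq_inner
      by (rule has_derivative_eq_rhs) (simp add: fun_eq_iff inner_complex_def algebra_simps)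
  qed
  show ?thesis
    unfolding jac_def jac_z_def
    by (rule DERIV_cong[OF DERIV_diff[OF *[OF holo_h] *[OF holo_g]]]) (simp add: algebra_simps)
qed

text \<open>
  At \<open>z = t e\<close> the product \<open>cnj z e\<close> is the real number \<open>t\<close>, so multiplying the complex differential
  inequality by \<open>e\<close> and taking real parts leaves only the derivative along the radius.
\<close>

lemma log_jac_radial_derivative:
  assumes e: "norm e = 1" and t: "\<bar>t\<bar> < 1"
  obtains l where "((\<lambda>t. ln (jac (of_real t * e))) has_real_derivative l) (at t)"
    "\<bar>(1 - t\<^sup>2) * l - 4 * t\<bar> \<le> 2 * \<beta>"
proof -
  define z where "z = of_real t * e"
  have z: "z \<in> ball 0 1" "norm z = \<bar>t\<bar>" unfolding z_def using e t by (simp_all add: norm_mult)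
  note J = jac_pos[OF z(1)]
  define l where "l = 2 * Re (jac_z z * e) / jac z"
  have 1: "((\<lambda>t. ln (jac (of_real t * e))) has_real_derivative l) (at t)"
    using DERIV_ln_divide[OF J[unfolded z_def]] jac_radial_derivative[OF e t]
    unfolding l_def z_def by (auto intro!: derivative_eq_intros simp: J[unfolded z_def])
  define B where "B = (1 - (norm z)\<^sup>2) * jac_z z - 2 * cnj z * jac z"
  have "cnj z * e = of_real t"
    unfolding z_def using e by (simp add: mult.assoc complex_norm_square[symmetric] mult.commute[of "cnj e"])
  then have "B * e = of_real (1 - t\<^sup>2) * (jac_z z * e) - of_real (2 * t * jac z)"
    unfolding B_def z(2) by (simp add: algebra_simps)
  moreover have "Re (of_real c * w) = c * Re w" for c w by simp
  ultimately have "Re (B * e) = (1 - t\<^sup>2) * Re (jac_z z * e) - 2 * t * jac z"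
    by (simp only: minus_complex.simps Re_complex_of_real)
  also have "\<dots> = jac z / 2 * ((1 - t\<^sup>2) * l - 4 * t)"
    unfolding l_def using J by (simp add: field_simps)
  finally have *: "Re (B * e) = jac z / 2 * ((1 - t\<^sup>2) * l - 4 * t)" .
  have "\<bar>Re (B * e)\<bar> \<le> norm B" using abs_Re_le_cmod[of "B * e"] e by (simp add: norm_mult)
  also have "\<dots> \<le> \<beta> * jac z"
    using jacobian_differential_inequality[OF z(1)] unfolding B_def weight_exponent_def .
  finally have "jac z * (\<bar>(1 - t\<^sup>2) * l - 4 * t\<bar>) \<le> jac z * (2 * \<beta>)"
    unfolding * abs_mult using J by simp
  then have "\<bar>(1 - t\<^sup>2) * l - 4 * t\<bar> \<le> 2 * \<beta>" using J by simp
  with 1 show ?thesis by (rule that)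
qed

lemma jacobian_bounds:
  assumes z: "z \<in> ball 0 1"
  shows "jac 0 * weight (norm z) \<le> jac z" "jac z \<le> jac 0 * weight (- norm z)"
proof -
  define r where "r = norm z"
  have r: "0 \<le> r" "r < 1" using z unfolding r_def by auto
  obtain e where e: "norm e = 1" "z = of_real r * e"
  proof (cases "z = 0")
    case True
    then show ?thesis using that[of 1] unfolding r_def by simp
  next
    case False
    then show ?thesis using that[of "z / of_real r"] unfolding r_def by (simp add: norm_divide)
  qed
  let ?l = "\<lambda>t. ln (jac (of_real t * e))"
  have lw0: "log_weight 0 = 0" unfolding log_weight_def by simp
  have "?l 0 - log_weight 0 \<le> ?l r - log_weight r"
  proof (rule DERIV_nonneg_imp_nondecreasing[OF r(1)])
    fix t assume "0 \<le> t" "t \<le> r"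
    then have t: "\<bar>t\<bar> < 1" using r by simp
    then have p: "1 - t\<^sup>2 > 0" by (simp add: abs_square_less_1)
    obtain l where l: "(?l has_real_derivative l) (at t)" "\<bar>(1 - t\<^sup>2) * l - 4 * t\<bar> \<le> 2 * \<beta>"
      using log_jac_radial_derivative[OF e(1) t] .
    have "l - (4 * t - 2 * \<beta>) / (1 - t\<^sup>2) \<ge> 0" using l(2) p by (simp add: field_simps)
    with DERIV_diff[OF l(1) log_weight_deriv[OF t]]
    show "\<exists>y. ((\<lambda>t. ?l t - log_weight t) has_real_derivative y) (at t) \<and> y \<ge> 0" by blast
  qed
  then have "exp (ln (jac 0) + log_weight r) \<le> exp (ln (jac z))" unfolding e(2) lw0 by simp
  then show "jac 0 * weight (norm z) \<le> jac z"
    unfolding exp_add using jac_pos[of 0] jac_pos[OF z] r by (simp add: weight_exp_log r_def)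
  have "?l r - log_weight (- r) \<le> ?l 0 - log_weight (- 0)"
  proof (rule DERIV_nonpos_imp_nonincreasing[OF r(1)])
    fix t assume "0 \<le> t" "t \<le> r"
    then have t: "\<bar>t\<bar> < 1" using r by simp
    then have p: "1 - t\<^sup>2 > 0" by (simp add: abs_square_less_1)
    obtain l where l: "(?l has_real_derivative l) (at t)" "\<bar>(1 - t\<^sup>2) * l - 4 * t\<bar> \<le> 2 * \<beta>"
      using log_jac_radial_derivative[OF e(1) t] .
    have "((\<lambda>t. log_weight (- t)) has_real_derivative (4 * (- t) - 2 * \<beta>) / (1 - (- t)\<^sup>2) * (- 1)) (at t)"
      by (rule DERIV_chain2[OF log_weight_deriv]) (use t in \<open>auto intro!: derivative_eq_intros\<close>)
    note d = DERIV_diff[OF l(1) this]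
    have "l - (4 * (- t) - 2 * \<beta>) / (1 - (- t)\<^sup>2) * (- 1) \<le> 0" using l(2) p by (simp add: field_simps)
    with d show "\<exists>y. ((\<lambda>t. ?l t - log_weight (- t)) has_real_derivative y) (at t) \<and> y \<le> 0" by blast
  qed
  then have "exp (ln (jac z)) \<le> exp (ln (jac 0) + log_weight (- r))" unfolding e(2) using lw0 by simp
  then show "jac z \<le> jac 0 * weight (- norm z)"
    unfolding exp_add using jac_pos[of 0] jac_pos[OF z] r by (simp add: weight_exp_log r_def)
qed

end

section \<open>Area\<close>

text \<open>
  A Riemann sum argument in place of differentiating \<open>Y\<close>: on a partition of \<open>[0, r]\<close> with mesh \<open>r / n\<close> the
  increments of \<open>X\<close> exceed those of \<open>Y\<close> by at most \<open>2 r (r / n)\<close> times the decrease of \<open>w\<close>, and these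
  errors add up to \<open>O(1 / n)\<close> by telescoping.
\<close>

lemma compare_increments:
  fixes X Y w :: "real \<Rightarrow> real"
  assumes r: "r \<ge> 0"
    and Y: "\<And>s t. 0 \<le> s \<Longrightarrow> s \<le> t \<Longrightarrow> t \<le> r \<Longrightarrow> (t\<^sup>2 - s\<^sup>2) * w t \<le> Y t - Y s"
    and X: "\<And>s t. 0 \<le> s \<Longrightarrow> s \<le> t \<Longrightarrow> t \<le> r \<Longrightarrow> X t - X s \<le> (t\<^sup>2 - s\<^sup>2) * w s"
    and w: "\<And>s t. 0 \<le> s \<Longrightarrow> s \<le> t \<Longrightarrow> t \<le> r \<Longrightarrow> w t \<le> w s"
  shows "X r - X 0 \<le> Y r - Y 0"
proof -
  have step: "(X t - X s) - (Y t - Y s) \<le> 2 * r * (t - s) * (w s - w t)"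
    if "0 \<le> s" "s \<le> t" "t \<le> r" for s t
  proof -
    have "(X t - X s) - (Y t - Y s) \<le> (t\<^sup>2 - s\<^sup>2) * (w s - w t)"
      using X[OF that] Y[OF that] by (simp add: algebra_simps)
    also have "t\<^sup>2 - s\<^sup>2 = (t + s) * (t - s)" by (simp add: power2_eq_square algebra_simps)
    also have "(t + s) * (t - s) * (w s - w t) \<le> 2 * r * (t - s) * (w s - w t)"
      using that w[OF that] by (intro mult_right_mono) auto
    finally show ?thesis .
  qed
  have bound: "(X r - X 0) - (Y r - Y 0) \<le> 2 * r * r * (w 0 - w r) / real (Suc n)" for n
  proof -
    define N where "N = real (Suc n)"
    have N: "N > 0" unfolding N_def by simp
    define p where "p k = r * real k / N" for k
    have "(X r - X 0) - (Y r - Y 0) = (\<Sum>k<Suc n. (X (p (Suc k)) - Y (p (Suc k))) - (X (p k) - Y (p k)))"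
      unfolding sum_lessThan_telescope[of "\<lambda>k. X (p k) - Y (p k)"] using N by (simp add: p_def N_def)
    also have "\<dots> \<le> (\<Sum>k<Suc n. 2 * r * (r / N) * (w (p k) - w (p (Suc k))))"
    proof (rule sum_mono)
      fix k assume "k \<in> {..<Suc n}"
      then have k: "real (Suc k) \<le> N" unfolding N_def by simp
      have "p (Suc k) - p k = r / N" unfolding p_def using N by (simp add: field_simps)
      moreover have "0 \<le> p k" unfolding p_def using r N by simp
      moreover have "p (Suc k) \<le> r"
        unfolding p_def using mult_left_mono[OF k r] N by (simp add: field_simps)
      moreover have "0 \<le> r / N" using r N by simp
      ultimately show "(X (p (Suc k)) - Y (p (Suc k))) - (X (p k) - Y (p k)) \<le> 2 * r * (r / N) * (w (p k) - w (p (Suc k)))"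
        using step[of "p k" "p (Suc k)"] by simp
    qed
    also have "\<dots> = 2 * r * (r / N) * (\<Sum>k<Suc n. w (p k) - w (p (Suc k)))"
      by (rule sum_distrib_left[symmetric])
    also have "\<dots> = 2 * r * r * (w 0 - w r) / N"
      unfolding sum_lessThan_telescope'[of "\<lambda>k. w (p k)"] using N by (simp add: p_def N_def)
    finally show ?thesis unfolding N_def .
  qed
  have "(X r - X 0) - (Y r - Y 0) \<le> 0"
    by (rule LIMSEQ_le_const[OF LIMSEQ_Suc[OF lim_const_over_n[of "2 * r * r * (w 0 - w r)"]]])
      (use bound in blast)
  then show ?thesis by simp
qed

text \<open>
  The change of variables theorem speaks of the spaces \<open>real ^ 'n\<close>, so areas of plane sets are moved to
  \<open>real ^ 2\<close> along this isometry.
\<close>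

definition complex_of_plane :: "real ^ 2 \<Rightarrow> complex" where
  "complex_of_plane x = of_real (x $ 1) + \<i> * of_real (x $ 2)"

definition plane_of_complex :: "complex \<Rightarrow> real ^ 2" where
  "plane_of_complex z = (\<chi> i. if i = 1 then Re z else Im z)"

lemma plane_of_complex_nth [simp]: "plane_of_complex z $ 1 = Re z" "plane_of_complex z $ 2 = Im z"
  unfolding plane_of_complex_def by simp_all

lemma complex_of_plane_Re_Im [simp]: "Re (complex_of_plane x) = x $ 1" "Im (complex_of_plane x) = x $ 2"
  unfolding complex_of_plane_def by simp_all

lemma complex_of_plane_of_complex [simp]: "complex_of_plane (plane_of_complex z) = z"
  by (simp add: complex_eq_iff)

lemma plane_of_complex_of_plane [simp]: "plane_of_complex (complex_of_plane x) = x"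
  by (simp add: vec_eq_iff forall_2)

lemma bounded_linear_complex_of_plane: "bounded_linear complex_of_plane"
  unfolding complex_of_plane_def
  by (intro bounded_linear_add bounded_linear_of_real bounded_linear_vec_nth
      bounded_linear_const_mult[OF bounded_linear_compose[OF bounded_linear_of_real]]
      bounded_linear_compose[OF bounded_linear_of_real bounded_linear_vec_nth])

lemma bounded_linear_plane_of_complex: "bounded_linear plane_of_complex"
proof -
  have "linear plane_of_complex"
    by (rule linearI) (simp_all add: vec_eq_iff forall_2)
  then show ?thesis by (rule linear_conv_bounded_linear[THEN iffD1])
qed

lemma norm_complex_of_plane [simp]: "norm (complex_of_plane x) = norm x"
  by (simp add: cmod_def norm_vec_def L2_set_def sum_2)

lemma complex_of_plane_image_ball: "complex_of_plane ` ball 0 r = ball 0 r"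
proof -
  have "x \<in> complex_of_plane ` ball 0 r" if "x \<in> ball 0 r" for x
    using that norm_complex_of_plane[of "plane_of_complex x"] by (intro image_eqI[of _ _ "plane_of_complex x"]) auto
  then show ?thesis by auto
qed

lemma lborel_complex: "lborel = distr lborel borel complex_of_plane"
proof (rule lborel_eqI)
  have [measurable]: "complex_of_plane \<in> borel_measurable borel"
    using bounded_linear_complex_of_plane linear_continuous_on borel_measurable_continuous_onI by blast
  fix l u :: complex
  assume lu: "\<And>b. b \<in> Basis \<Longrightarrow> l \<bullet> b \<le> u \<bullet> b"
  have le: "Re l \<le> Re u" "Im l \<le> Im u"
    using lu[of 1] lu[of \<i>] by (simp_all add: Basis_complex_def)
  have B: "(Basis :: (real ^ 2) set) = {axis 1 1, axis 2 1}"
    unfolding Basis_vec_def by (auto simp: UNIV_2)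
  have ne: "axis 1 1 \<noteq> (axis 2 1 :: real ^ 2)" by (simp add: axis_eq_axis)
  have "complex_of_plane -` box l u = box (plane_of_complex l) (plane_of_complex u)"
    by (auto simp: box_def B Basis_complex_def inner_axis)
  then have "emeasure (distr lborel borel complex_of_plane) (box l u) = emeasure lborel (box (plane_of_complex l) (plane_of_complex u))"
    by (simp add: emeasure_distr)
  also have "\<dots> = (\<Prod>b\<in>Basis. (plane_of_complex u - plane_of_complex l) \<bullet> b)"
    by (rule emeasure_lborel_box) (auto simp: B inner_axis le)
  also have "(\<Prod>b\<in>Basis. (plane_of_complex u - plane_of_complex l) \<bullet> b) = (\<Prod>b\<in>Basis. (u - l) \<bullet> b)"
    unfolding B Basis_complex_def using ne by (simp add: inner_axis)
  finally show "emeasure (distr lborel borel complex_of_plane) (box l u) = (\<Prod>b\<in>Basis. (u - l) \<bullet> b)" .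
qed simp

lemma measure_open_complex:
  assumes "open U"
  shows "measure lebesgue U = measure lebesgue (complex_of_plane -` U)"
proof -
  have m: "complex_of_plane \<in> borel_measurable borel"
    using bounded_linear_complex_of_plane linear_continuous_on borel_measurable_continuous_onI by blast
  have o: "open (complex_of_plane -` U)"
    using assms bounded_linear_complex_of_plane linear_continuous_on open_vimage by blast
  have "measure lebesgue U = measure (distr lborel borel complex_of_plane) U"
    using assms lborel_complex by (simp add: measure_completion)
  also have "\<dots> = measure lborel (complex_of_plane -` U)"
    using assms m by (subst measure_distr) auto
  also have "\<dots> = measure lebesgue (complex_of_plane -` U)" using o by (simp add: measure_completion)
  finally show ?thesis .
qed

lemma det_real_linear:
  "det (matrix (\<lambda>v. plane_of_complex (real_linear p q (complex_of_plane v)))) = (cmod p)\<^sup>2 - (cmod q)\<^sup>2"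
proof -
  have "complex_of_plane (axis 1 1) = 1" "complex_of_plane (axis 2 1) = \<i>"
    by (simp_all add: complex_eq_iff axis_def)
  then show ?thesis
    unfolding det_2 matrix_def cmod_power2 real_linear_def
    by (simp add: power2_eq_square algebra_simps axis_def)
qed

lemma integrable_on_subset_compact:
  fixes F :: "'a::euclidean_space \<Rightarrow> real"
  assumes "compact K" "continuous_on K F" "B \<in> sets borel" "B \<subseteq> K"
  shows "F integrable_on B"
proof -
  have "set_integrable lborel K F"
    using borel_integrable_compact[OF assms(1,2)] unfolding set_integrable_def
    by (simp add: indicator_def if_distrib[of "\<lambda>c. c *\<^sub>R _"] cong: if_cong)
  then have "set_integrable lborel B F" by (rule set_integrable_subset) (use assms in auto)
  then show ?thesis by (rule set_borel_integral_eq_integral(1))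
qed

context absolutely_convex_map begin

lemma continuous_on_jac: "continuous_on (ball 0 1) jac"
  unfolding jac_def
  by (intro continuous_intros holomorphic_on_imp_continuous_on holomorphic_deriv holo_h holo_g) auto

lemma cont_jac_plane:
  assumes "r < 1" shows "continuous_on (cball 0 r) (\<lambda>x. jac (complex_of_plane x))"
  by (rule continuous_on_compose2[OF continuous_on_jac linear_continuous_on[OF bounded_linear_complex_of_plane]])
     (use assms in auto)

lemma area_eq_integral:
  assumes r: "r < 1"
  shows "measure lebesgue (f ` ball 0 r) = integral (ball 0 r) (\<lambda>x. jac (complex_of_plane x))"
proof -
  let ?F = "\<lambda>x. plane_of_complex (f (complex_of_plane x))"
  let ?F' = "\<lambda>x v. plane_of_complex (real_linear (deriv h (complex_of_plane x)) (deriv g (complex_of_plane x)) (complex_of_plane v))"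
  have sub: "ball 0 r \<subseteq> ball (0::complex) 1" using r by auto
  have "open (f ` ball 0 r)"
    using sub by (intro invariance_of_domain continuous_on_subset[OF cont_f] inj_on_subset[OF univalent]) auto
  moreover have "complex_of_plane -` (f ` ball 0 r) = ?F ` ball 0 r"
  proof -
    have "complex_of_plane -` X = plane_of_complex ` X" for X
      using plane_of_complex_of_plane complex_of_plane_of_complex by (auto intro!: image_eqI)
    then have "complex_of_plane -` (f ` complex_of_plane ` ball 0 r) = ?F ` ball 0 r" by (simp only: image_image)
    then show ?thesis unfolding complex_of_plane_image_ball .
  qed
  ultimately have "measure lebesgue (f ` ball 0 r) = measure lebesgue (?F ` ball 0 r)"
    using measure_open_complex by metis
  also have "\<dots> = integral (ball 0 r) (\<lambda>x. \<bar>det (matrix (?F' x))\<bar>)"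
  proof (rule measure_differentiable_image_eq)
    fix x :: "real ^ 2" assume x: "x \<in> ball 0 r"
    then have tx: "complex_of_plane x \<in> ball 0 1" using r by simp
    have 1: "(complex_of_plane has_derivative complex_of_plane) (at x within ball 0 r)"
      by (rule bounded_linear_imp_has_derivative[OF bounded_linear_complex_of_plane])
    show "(?F has_derivative ?F' x) (at x within ball 0 r)"
      by (rule bounded_linear.has_derivative[OF bounded_linear_plane_of_complex has_derivative_compose[OF 1 der_f[OF tx]]])
  next
    show "inj_on ?F (ball 0 r)"
    proof (rule inj_onI)
      fix x y :: "real ^ 2" assume xy: "x \<in> ball 0 r" "y \<in> ball 0 r" "?F x = ?F y"
      then have "f (complex_of_plane x) = f (complex_of_plane y)" by (metis complex_of_plane_of_complex)
      then have "complex_of_plane x = complex_of_plane y" using univalent xy(1,2) r by (simp add: inj_on_def)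
      then show "x = y" by (metis plane_of_complex_of_plane)
    qed
    have "(\<lambda>x. jac (complex_of_plane x)) integrable_on ball 0 r"
      by (rule integrable_on_subset_compact[OF compact_cball cont_jac_plane[OF r]]) auto
    then show "(\<lambda>x. \<bar>det (matrix (?F' x))\<bar>) integrable_on ball 0 r"
    proof (rule integrable_eq)
      fix x :: "real ^ 2" assume "x \<in> ball 0 r"
      then have "jac (complex_of_plane x) > 0" using r by (intro jac_pos) auto
      then show "jac (complex_of_plane x) = \<bar>det (matrix (?F' x))\<bar>" unfolding det_real_linear jac_def by simp
    qed
  qed simp
  also have "\<dots> = integral (ball 0 r) (\<lambda>x. jac (complex_of_plane x))"
  proof (rule integral_cong)
    fix x :: "real ^ 2" assume "x \<in> ball 0 r"
    then have "jac (complex_of_plane x) > 0" using r by (intro jac_pos) auto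
    then show "\<bar>det (matrix (?F' x))\<bar> = jac (complex_of_plane x)" unfolding det_real_linear jac_def by simp
  qed
  finally show ?thesis .
qed

text \<open>
  Bounds on an annulus suffice for comparing areas with radial functions, without any use of polar
  coordinates.
\<close>

lemma area_increment:
  assumes st: "0 \<le> s" "s \<le> t" "t < 1"
    and J: "\<And>z. s \<le> norm z \<Longrightarrow> norm z < t \<Longrightarrow> lo \<le> jac z \<and> jac z \<le> hi"
  shows "lo * (pi * (t\<^sup>2 - s\<^sup>2)) \<le> measure lebesgue (f ` ball 0 t) - measure lebesgue (f ` ball 0 s)"
    and "measure lebesgue (f ` ball 0 t) - measure lebesgue (f ` ball 0 s) \<le> hi * (pi * (t\<^sup>2 - s\<^sup>2))"
proof -
  let ?S = "ball 0 t - ball 0 s :: (real ^ 2) set"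
  let ?j = "\<lambda>x. jac (complex_of_plane x)"
  have int: "?j integrable_on B" if "B \<in> sets borel" "B \<subseteq> ball 0 t" for B
    by (rule integrable_on_subset_compact[OF compact_cball cont_jac_plane[OF st(3)]])
       (use that ball_subset_cball in auto)
  have sub: "ball 0 s \<subseteq> (ball 0 t :: (real ^ 2) set)" using st by auto
  have split: "ball 0 t = ball 0 s \<union> ?S" using sub by blast
  have "integral (ball 0 s \<union> ?S) ?j = integral (ball 0 s) ?j + integral ?S ?j"
    by (rule integral_Un) (use int[of "ball 0 s"] int[of ?S] sub in auto)
  then have A: "measure lebesgue (f ` ball 0 t) - measure lebesgue (f ` ball 0 s) = integral ?S ?j"
    using split st by (simp add: area_eq_integral)
  have "measure lebesgue ?S = measure lebesgue (ball (0 :: real ^ 2) t) - measure lebesgue (ball (0 :: real ^ 2) s)"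
    using sub by (intro measurable_measure_Diff) auto
  also have "\<dots> = pi * (t\<^sup>2 - s\<^sup>2)"
    using circle_area[of t 0] circle_area[of s 0] st
    by (simp add: measure_completion algebra_simps)
  finally have area: "measure lebesgue ?S = pi * (t\<^sup>2 - s\<^sup>2)" .
  have const: "((\<lambda>x. c) has_integral c * (pi * (t\<^sup>2 - s\<^sup>2))) ?S" for c :: real
  proof -
    have "emeasure lborel ?S < \<infinity>" by (rule emeasure_bounded_finite) (simp add: bounded_diff)
    from has_integral_mult_right[OF has_integral_measure_lborel[OF _ this], of c]
    show ?thesis using area by (simp add: measure_completion)
  qed
  have j: "(?j has_integral integral ?S ?j) ?S" using int[of ?S] by auto
  show "lo * (pi * (t\<^sup>2 - s\<^sup>2)) \<le> measure lebesgue (f ` ball 0 t) - measure lebesgue (f ` ball 0 s)"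
    unfolding A by (rule has_integral_le[OF const j]) (use J in auto)
  show "measure lebesgue (f ` ball 0 t) - measure lebesgue (f ` ball 0 s) \<le> hi * (pi * (t\<^sup>2 - s\<^sup>2))"
    unfolding A by (rule has_integral_le[OF j const]) (use J in auto)
qed

text \<open>
  Both estimates are instances of \<open>compare_increments\<close>. For the upper one the radial bound
  \<open>weight (- t)\<close> increases, and the areas and primitives enter with a minus sign to restore monotonicity.
\<close>

lemma area_bounds:
  assumes r: "0 < r" "r < 1"
  shows "pi * jac 0 / 26 * weight_primitive r \<le> measure lebesgue (f ` ball 0 r)"
    and "measure lebesgue (f ` ball 0 r) \<le> pi * jac 0 / 26 * weight_primitive (- r)"
proof -
  let ?A = "\<lambda>t. measure lebesgue (f ` ball 0 t)"
  let ?c = "pi * jac 0"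
  have c: "?c > 0" using jac_pos[of 0] by simp
  have factor: "?c / 26 * (26 * x * y) = x * (?c * y)" for x y by simp
  have wp0: "weight_primitive 0 = 0" unfolding weight_primitive_def by simp
  have sandwich: "jac 0 * weight t \<le> jac z \<and> jac z \<le> jac 0 * weight (- t)"
    if "norm z < t" "t < 1" for z t
  proof -
    have z: "z \<in> ball 0 1" using that by simp
    have n0: "- 1 < norm z" by (rule less_le_trans[OF _ norm_ge_zero]) simp
    have "jac 0 * weight t \<le> jac 0 * weight (norm z)"
      using jac_pos[of 0] by (intro mult_left_mono weight_antimono) (use that n0 in simp_all)
    moreover have "jac 0 * weight (- norm z) \<le> jac 0 * weight (- t)"
      using jac_pos[of 0] by (intro mult_left_mono weight_antimono) (use that n0 in simp_all)
    ultimately show ?thesis using jacobian_bounds[OF z] by linarith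
  qed
  have inc: "(t\<^sup>2 - s\<^sup>2) * (?c * weight t) \<le> ?A t - ?A s" "?A t - ?A s \<le> (t\<^sup>2 - s\<^sup>2) * (?c * weight (- t))"
    if "0 \<le> s" "s \<le> t" "t < 1" for s t
    using area_increment[OF that, of "jac 0 * weight t" "jac 0 * weight (- t)"] sandwich[OF _ that(3)]
    by (simp_all add: mult_ac)
  have "?c / 26 * weight_primitive r - ?c / 26 * weight_primitive 0 \<le> ?A r - ?A 0"
  proof (rule compare_increments[where w = "\<lambda>t. ?c * weight t"])
    fix s t assume st: "0 \<le> s" "s \<le> t" "t \<le> r"
    show "(t\<^sup>2 - s\<^sup>2) * (?c * weight t) \<le> ?A t - ?A s" using inc st r by simp
    show "?c * weight t \<le> ?c * weight s"
      using c st r by (intro mult_left_mono weight_antimono) auto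
    have "?c / 26 * (weight_primitive t - weight_primitive s) \<le> ?c / 26 * (26 * (t\<^sup>2 - s\<^sup>2) * weight s)"
      using c st r by (intro mult_left_mono weight_primitive_increment) auto
    then show "?c / 26 * weight_primitive t - ?c / 26 * weight_primitive s \<le> (t\<^sup>2 - s\<^sup>2) * (?c * weight s)"
      unfolding factor unfolding right_diff_distrib by linarith
  qed (use r in simp)
  then show "pi * jac 0 / 26 * weight_primitive r \<le> ?A r" by (simp add: wp0)
  have "- (?c / 26 * weight_primitive (- r)) - (- (?c / 26 * weight_primitive (- 0))) \<le> - ?A r - (- ?A 0)"
  proof (rule compare_increments[where w = "\<lambda>t. - (?c * weight (- t))"])
    fix s t assume st: "0 \<le> s" "s \<le> t" "t \<le> r"
    have "?A t - ?A s \<le> (t\<^sup>2 - s\<^sup>2) * (?c * weight (- t))" using inc st r by simp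
    then show "(t\<^sup>2 - s\<^sup>2) * - (?c * weight (- t)) \<le> - ?A t - (- ?A s)"
      unfolding mult_minus_right by linarith
    have "?c * weight (- s) \<le> ?c * weight (- t)"
      using c st r by (intro mult_left_mono weight_antimono) auto
    then show "- (?c * weight (- t)) \<le> - (?c * weight (- s))" by simp
    have "?c / 26 * (26 * (t\<^sup>2 - s\<^sup>2) * weight (- s)) \<le> ?c / 26 * (weight_primitive (- t) - weight_primitive (- s))"
      using c st r by (intro mult_left_mono weight_primitive_increment) auto
    then show "- (?c / 26 * weight_primitive (- t)) - (- (?c / 26 * weight_primitive (- s))) \<le>
        (t\<^sup>2 - s\<^sup>2) * - (?c * weight (- s))"
      unfolding factor unfolding right_diff_distrib mult_minus_right by linarith
  qed (use r in simp)
  then show "?A r \<le> pi * jac 0 / 26 * weight_primitive (- r)" by (simp add: wp0)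
qed

end

theorem theorem3:
  fixes f :: "complex \<Rightarrow> complex" and b\<^sub>1 :: complex
  assumes "f \<in> absolutely_convex_harmonic"
    and "sense_preserving f"
    and "b\<^sub>1 = deriv_zbar f 0"
  shows "(\<forall>z\<in>ball 0 1.
            (1 - (norm b\<^sub>1)\<^sup>2) *
              ((1 - norm z) powr (4 / sqrt 3 - 2) / (1 + norm z) powr (4 / sqrt 3 + 2))
              \<le> wirtinger_jacobian f z \<and>
            wirtinger_jacobian f z \<le> (1 - (norm b\<^sub>1)\<^sup>2) *
              ((1 + norm z) powr (4 / sqrt 3 - 2) / (1 - norm z) powr (4 / sqrt 3 + 2)))
       \<and> (\<forall>r. 0 < r \<and> r < 1 \<longrightarrow>
            pi * (1 - (norm b\<^sub>1)\<^sup>2) / 26 *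
              (3 - (3 * r\<^sup>2 + 8 * sqrt 3 * r + 3) *
                ((1 - r) powr (4 / sqrt 3 - 1) / (1 + r) powr (4 / sqrt 3 + 1)))
              \<le> measure lebesgue (f ` ball 0 r) \<and>
            measure lebesgue (f ` ball 0 r) \<le> pi * (1 - (norm b\<^sub>1)\<^sup>2) / 26 *
              (3 - (3 * r\<^sup>2 - 8 * sqrt 3 * r + 3) *
                ((1 + r) powr (4 / sqrt 3 - 1) / (1 - r) powr (4 / sqrt 3 + 1))))"
proof -
  obtain h g where hg: "h holomorphic_on ball 0 1" "g holomorphic_on ball 0 1" "deriv h 0 = 1"
      "\<forall>z\<in>ball 0 1. f z = h z + cnj (g z)"
    using assms(1) unfolding absolutely_convex_harmonic_def normalized_harmonic_def by blast
  have "(f has_derivative real_linear (deriv h z) (deriv g z)) (at z)" if "z \<in> ball 0 1" for z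
    using harmonic_has_derivative[OF hg(1,2) _ that, of f] hg(4) by blast
  note wirt = wirtinger_harmonic[OF this]
  interpret absolutely_convex_map f h g
  proof
    show "norm (deriv g z) < norm (deriv h z)" if "z \<in> ball 0 1" for z
    proof (rule power2_less_imp_less)
      show "(norm (deriv g z))\<^sup>2 < (norm (deriv h z))\<^sup>2"
        using assms(2) wirt(2)[OF that] that unfolding sense_preserving_def by force
    qed simp
  qed (use hg assms(1) in \<open>auto simp: absolutely_convex_harmonic_def\<close>)
  have jac: "wirtinger_jacobian f z = jac z" if "z \<in> ball 0 1" for z
    using wirt(2)[OF that] unfolding jac_def .
  have "b\<^sub>1 = cnj (deriv g 0)" using wirt(1)[of 0] assms(3) by simp
  then have jac0: "jac 0 = 1 - (norm b\<^sub>1)\<^sup>2" unfolding jac_def hg(3) by simp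
  show ?thesis
    using jacobian_bounds area_bounds
    unfolding weight_def weight_primitive_def weight_exponent_def jac0[symmetric]
    by (auto simp: jac)
qed

end
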